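(* Let $m\ge1$ be an integer, $m-1<\mu<m$, $\rho>0$, $\gamma,\omega\in\mathbb C$, $R=\mathcal E_{\rho,\mu,\omega}^{\gamma}$, $0\le\beta_j<\mu$ and $p_j\in C[0,T]$ for $1\le j\le N$, and $K\in C(\Delta_T)$. For every $f\in C[0,T]$ and every $\mathbf d=(d_0,\dots,d_{m-1})\in\mathbb C^m$, the boundary-extended equation $${}^C\mathfrak D_{\rho,\mu,\omega}^{\gamma,[m]}u(t)+\sum_{j=1}^{N}p_j(t)\,{}^CD_{\beta_j,\partial}^{[m]}u(t)+\int_0^tK(t,s)u(s)\,ds=f(t),\qquad u^{(k)}(0)=d_k,\ 0\le k<m,$$ has a unique solution in the affine slice $P_{\mathbf d}+R(C[0,T])$, where $P_{\mathbf d}(t)=\sum_{k=0}^{m-1}d_kt^k/k!$. It is $$u=P_{\mathbf d}+\mathcal E_{\rho,\mu,\omega}^{\gamma}(I-V_{R_P})F_{\mathbf d},\qquad F_{\mathbf d}(t)=f(t)-\sum_{j=1}^{N}p_j(t)\,{}^CD^{\beta_j}P_{\mathbf d}(t)-\int_0^tK(t,s)P_{\mathbf d}(s)\,ds ,$$ where $R_P$ is the resolvent kernel generated by $$G_P(t,s)=\sum_{j=1}^{N}p_j(t)(t-s)^{\mu-\beta_j-1}E_{\rho,\mu-\beta_j}^{\gamma}\bigl(\omega(t-s)^\rho\bigr)+\int_s^tK(t,\xi)(\xi-s)^{\mu-1}E_{\rho,\mu}^{\gamma}\bigl(\omega(\xi-s)^\rho\bigr)\,d\xi .$$ The reduced kernel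 $G_P$, and hence its resolvent, is independent of the prescribed jet vector $\mathbf d$.
   Context: Fix $T>0$; functions are complex-valued; $X=C[0,T]$; $\Delta_T=\{(t,s):0\le s\le t\le T\}$; $(V_Gf)(t)=\int_0^tG(t,s)f(s)\,ds$. For $\rho,\mu>0$ and $\gamma,z\in\mathbb C$, $E_{\rho,\mu}^{\gamma}(z)=\sum_{n\ge0}\frac{(\gamma)_n}{n!\,\Gamma(\rho n+\mu)}z^n$ (three-parameter Mittag--Leffler function, $(\gamma)_n$ the Pochhammer symbol), and $(\mathcal E_{\rho,\mu,\omega}^{\gamma}f)(t)=\int_0^t(t-s)^{\mu-1}E_{\rho,\mu}^{\gamma}(\omega(t-s)^\rho)f(s)\,ds$. Let $\mathcal P_{m-1}$ be the polynomials of degree at most $m-1$ and $e_k(t)=t^k/k!$. The operator $R$ is injective on $X$, every $Rv$ ($v\in X$) lies in $C^{m-1}[0,T]$ with all derivatives of order $0,\dots,m-1$ vanishing at $0$, and so $\mathcal P_{m-1}\oplus R(X)$ is a direct sum. On it define, for $P\in\mathcal P_{m-1}$, $v\in X$, $${}^C\mathfrak D_{\rho,\mu,\omega}^{\gamma,[m]}(P+Rv)=v,\qquad {}^CD_{\beta,\partial}^{[m]}(P+Rv)={}^CD^\beta P+\mathcal E_{\rho,\mu-\beta,\omega}^{\gamma}v\quad(0\le\beta<\mu),$$ where ${}^CD^\beta$ is the Caputo derivative, given on $\mathcal P_{m-1}$ linearly by ${}^CD^\beta e_k=0$ if $k<\lceil\beta\rceil$ and ${}^CD^\beta e_k=t^{k-\beta}/\Gamma(k+1-\beta)$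 if $k\ge\lceil\beta\rceil$ ($\lceil0\rceil=0$). Resolvent kernel: for a measurable kernel $G$ on $\{0\le s<t\le T\}$ with $V_G:X\to X$ and $|G(t,s)|\le C(t-s)^{\eta-1}$ a.e. for some $C,\eta>0$, put $G_1=G$, $G_{n+1}(t,s)=\int_s^tG(t,\xi)G_n(\xi,s)\,d\xi$; the resolvent kernel generated by $G$ is $R_G(t,s)=\sum_{n\ge1}(-1)^{n-1}G_n(t,s)$ (the series converges absolutely for a.e. $(t,s)$, and the induced operator series converges in operator norm on $X$ to $V_{R_G}$). *)

theory Defs
  imports "HOL-Analysis.Analysis" "HOL-Computational_Algebra.Polynomial"
begin

text \<open>
  Elements of \<open>C[0,T]\<close> are functions of type \<open>real \<Rightarrow> complex\<close> that are continuous on \<open>{0..T}\<close>;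
  only their values on \<open>{0..T}\<close> matter, so two of them are identified when they agree there.
  Integrals are Lebesgue integrals, and measurable means Borel measurable.
\<close>

definition mittag_leffler3 :: "real \<Rightarrow> real \<Rightarrow> complex \<Rightarrow> complex \<Rightarrow> complex" where
  "mittag_leffler3 \<rho> \<mu> \<gamma> z =
     (\<Sum>n. pochhammer \<gamma> n / (fact n * of_real (Gamma (\<rho> * real n + \<mu>))) * z ^ n)"

definition prabhakar_kernel :: "real \<Rightarrow> real \<Rightarrow> complex \<Rightarrow> complex \<Rightarrow> real \<Rightarrow> complex" where
  "prabhakar_kernel \<rho> \<mu> \<omega> \<gamma> x =
     of_real (x powr (\<mu> - 1)) * mittag_leffler3 \<rho> \<mu> \<gamma> (\<omega> * of_real (x powr \<rho>))"

definition volterra :: "(real \<Rightarrow> real \<Rightarrow> complex) \<Rightarrow> (real \<Rightarrow> complex) \<Rightarrow> real \<Rightarrow> complex" where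
  "volterra G f t = (LINT s:{0..t}|lborel. G t s * f s)"

definition prabhakar ::
  "real \<Rightarrow> real \<Rightarrow> complex \<Rightarrow> complex \<Rightarrow> (real \<Rightarrow> complex) \<Rightarrow> real \<Rightarrow> complex" where
  "prabhakar \<rho> \<mu> \<omega> \<gamma> f t = (LINT s:{0..t}|lborel. prabhakar_kernel \<rho> \<mu> \<omega> \<gamma> (t - s) * f s)"

text \<open>
  Polynomials of degree at most \<open>m - 1\<close> (\<open>m \<ge> 1\<close>) are elements \<open>P\<close> of \<open>complex poly\<close> with
  \<open>degree P < m\<close>, evaluated at real arguments. With \<open>e\<^sub>k(t) = t\<^sup>k/k!\<close>, the coordinate of \<open>P\<close>
  at \<open>e\<^sub>k\<close> is \<open>k! * coeff P k\<close>. The case \<open>k = \<beta>\<close> is separated because the power \<open>t\<^sup>0\<close> is \<open>1\<close> also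
  at \<open>t = 0\<close>, whereas \<open>0 powr 0 = 0\<close>.
\<close>

definition caputo_monomial :: "real \<Rightarrow> nat \<Rightarrow> real \<Rightarrow> complex" where
  "caputo_monomial \<beta> k t =
     (if int k < \<lceil>\<beta>\<rceil> then 0
      else if real k = \<beta> then 1
      else of_real (t powr (real k - \<beta>) / Gamma (real k + 1 - \<beta>)))"

definition caputo_poly :: "real \<Rightarrow> complex poly \<Rightarrow> real \<Rightarrow> complex" where
  "caputo_poly \<beta> P t = (\<Sum>k\<le>degree P. fact k * coeff P k * caputo_monomial \<beta> k t)"

definition decomposes ::
  "real \<Rightarrow> nat \<Rightarrow> real \<Rightarrow> real \<Rightarrow> complex \<Rightarrow> complex \<Rightarrow>
   (real \<Rightarrow> complex) \<Rightarrow> complex poly \<Rightarrow> (real \<Rightarrow> complex) \<Rightarrow> bool" where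
  "decomposes T m \<rho> \<mu> \<omega> \<gamma> u P v \<longleftrightarrow>
     degree P < m \<and> continuous_on {0..T} v \<and>
     (\<forall>t\<in>{0..T}. u t = poly P (of_real t) + prabhakar \<rho> \<mu> \<omega> \<gamma> v t)"

text \<open>
  Since the sum of the polynomials and the range of the Prabhakar operator is direct and the
  operator is injective, the two components selected here are unique: \<open>P\<close> as a
  polynomial, \<open>v\<close> as a function on \<open>{0..T}\<close>.
\<close>

definition components ::
  "real \<Rightarrow> nat \<Rightarrow> real \<Rightarrow> real \<Rightarrow> complex \<Rightarrow> complex \<Rightarrow>
   (real \<Rightarrow> complex) \<Rightarrow> complex poly \<times> (real \<Rightarrow> complex)" where
  "components T m \<rho> \<mu> \<omega> \<gamma> u = (SOME (P, v). decomposes T m \<rho> \<mu> \<omega> \<gamma> u P v)"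

definition ext_deriv ::
  "real \<Rightarrow> nat \<Rightarrow> real \<Rightarrow> real \<Rightarrow> complex \<Rightarrow> complex \<Rightarrow> (real \<Rightarrow> complex) \<Rightarrow> real \<Rightarrow> complex" where
  "ext_deriv T m \<rho> \<mu> \<omega> \<gamma> u = snd (components T m \<rho> \<mu> \<omega> \<gamma> u)"

definition ext_caputo ::
  "real \<Rightarrow> nat \<Rightarrow> real \<Rightarrow> real \<Rightarrow> complex \<Rightarrow> complex \<Rightarrow> real \<Rightarrow>
   (real \<Rightarrow> complex) \<Rightarrow> real \<Rightarrow> complex" where
  "ext_caputo T m \<rho> \<mu> \<omega> \<gamma> \<beta> u t =
     caputo_poly \<beta> (fst (components T m \<rho> \<mu> \<omega> \<gamma> u)) t +
     prabhakar \<rho> (\<mu> - \<beta>) \<omega> \<gamma> (snd (components T m \<rho> \<mu> \<omega> \<gamma> u)) t"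

text \<open>Derivatives on \<open>[0,T]\<close> are one-sided at the end points.\<close>

definition deriv_on :: "real \<Rightarrow> (real \<Rightarrow> complex) \<Rightarrow> real \<Rightarrow> complex" where
  "deriv_on T u t = vector_derivative u (at t within {0..T})"

definition C_k_on :: "real \<Rightarrow> nat \<Rightarrow> (real \<Rightarrow> complex) \<Rightarrow> bool" where
  "C_k_on T n u \<longleftrightarrow>
     (\<forall>k<n. \<forall>t\<in>{0..T}. (deriv_on T ^^ k) u differentiable (at t within {0..T})) \<and>
     (\<forall>k\<le>n. continuous_on {0..T} ((deriv_on T ^^ k) u))"

definition has_initial_jet :: "real \<Rightarrow> nat \<Rightarrow> (real \<Rightarrow> complex) \<Rightarrow> (nat \<Rightarrow> complex) \<Rightarrow> bool" where
  "has_initial_jet T m u d \<longleftrightarrow> C_k_on T (m - 1) u \<and> (\<forall>k<m. (deriv_on T ^^ k) u 0 = d k)"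

definition jet_poly :: "nat \<Rightarrow> (nat \<Rightarrow> complex) \<Rightarrow> complex poly" where
  "jet_poly m d = (\<Sum>k<m. monom (d k / fact k) k)"

definition slice ::
  "real \<Rightarrow> nat \<Rightarrow> real \<Rightarrow> real \<Rightarrow> complex \<Rightarrow> complex \<Rightarrow> (nat \<Rightarrow> complex) \<Rightarrow> (real \<Rightarrow> complex) set" where
  "slice T m \<rho> \<mu> \<omega> \<gamma> d =
     {u. \<exists>v. continuous_on {0..T} v \<and>
         (\<forall>t\<in>{0..T}. u t = poly (jet_poly m d) (of_real t) + prabhakar \<rho> \<mu> \<omega> \<gamma> v t)}"

definition satisfies_equation ::
  "real \<Rightarrow> nat \<Rightarrow> real \<Rightarrow> real \<Rightarrow> complex \<Rightarrow> complex \<Rightarrow> nat \<Rightarrow> (nat \<Rightarrow> real \<Rightarrow> complex) \<Rightarrow>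
   (nat \<Rightarrow> real) \<Rightarrow> (real \<Rightarrow> real \<Rightarrow> complex) \<Rightarrow> (real \<Rightarrow> complex) \<Rightarrow> (real \<Rightarrow> complex) \<Rightarrow> bool" where
  "satisfies_equation T m \<rho> \<mu> \<omega> \<gamma> N p \<beta> K f u \<longleftrightarrow>
     (\<forall>t\<in>{0..T}. ext_deriv T m \<rho> \<mu> \<omega> \<gamma> u t
        + (\<Sum>j=1..N. p j t * ext_caputo T m \<rho> \<mu> \<omega> \<gamma> (\<beta> j) u t)
        + volterra K u t = f t)"

definition reduced_rhs ::
  "nat \<Rightarrow> nat \<Rightarrow> (nat \<Rightarrow> real \<Rightarrow> complex) \<Rightarrow> (nat \<Rightarrow> real) \<Rightarrow> (real \<Rightarrow> real \<Rightarrow> complex) \<Rightarrow>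
   (real \<Rightarrow> complex) \<Rightarrow> (nat \<Rightarrow> complex) \<Rightarrow> real \<Rightarrow> complex" where
  "reduced_rhs m N p \<beta> K f d t =
     f t - (\<Sum>j=1..N. p j t * caputo_poly (\<beta> j) (jet_poly m d) t)
         - volterra K (\<lambda>s. poly (jet_poly m d) (of_real s)) t"

definition reduced_kernel ::
  "real \<Rightarrow> real \<Rightarrow> complex \<Rightarrow> complex \<Rightarrow> nat \<Rightarrow> (nat \<Rightarrow> real \<Rightarrow> complex) \<Rightarrow>
   (nat \<Rightarrow> real) \<Rightarrow> (real \<Rightarrow> real \<Rightarrow> complex) \<Rightarrow> real \<Rightarrow> real \<Rightarrow> complex" where
  "reduced_kernel \<rho> \<mu> \<omega> \<gamma> N p \<beta> K t s =
     (\<Sum>j=1..N. p j t * prabhakar_kernel \<rho> (\<mu> - \<beta> j) \<omega> \<gamma> (t - s))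
     + (LINT \<xi>:{s..t}|lborel. K t \<xi> * prabhakar_kernel \<rho> \<mu> \<omega> \<gamma> (\<xi> - s))"

definition admissible_kernel :: "real \<Rightarrow> (real \<Rightarrow> real \<Rightarrow> complex) \<Rightarrow> bool" where
  "admissible_kernel T G \<longleftrightarrow>
     set_borel_measurable lborel {(t, s). 0 \<le> s \<and> s < t \<and> t \<le> T} (\<lambda>(t, s). G t s) \<and>
     (\<forall>f. continuous_on {0..T} f \<longrightarrow>
        (\<forall>t\<in>{0..T}. set_integrable lborel {0..t} (\<lambda>s. G t s * f s)) \<and>
        continuous_on {0..T} (volterra G f)) \<and>
     (\<exists>C>0. \<exists>\<eta>>0. AE (t, s) in lborel.
        0 \<le> s \<and> s < t \<and> t \<le> T \<longrightarrow> norm (G t s) \<le> C * (t - s) powr (\<eta> - 1))"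

text \<open>The index is shifted by one: \<open>iter_kernel G n\<close> is \<open>G\<^sub>n\<^sub>+\<^sub>1\<close>.\<close>

primrec iter_kernel :: "(real \<Rightarrow> real \<Rightarrow> complex) \<Rightarrow> nat \<Rightarrow> real \<Rightarrow> real \<Rightarrow> complex" where
  "iter_kernel G 0 = G"
| "iter_kernel G (Suc n) = (\<lambda>t s. LINT \<xi>:{s..t}|lborel. G t \<xi> * iter_kernel G n \<xi> s)"

definition resolvent_kernel :: "(real \<Rightarrow> real \<Rightarrow> complex) \<Rightarrow> real \<Rightarrow> real \<Rightarrow> complex" where
  "resolvent_kernel G t s = (\<Sum>n. (-1) ^ n * iter_kernel G n t s)"

end

theory Submission
  imports Defs
begin

text \<open>
  On the slice \<open>P + R v\<close>, where \<open>P\<close> is the polynomial with the given jet and \<open>R\<close> the Prabhakar operator,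
  the equation becomes a Volterra equation of the second kind \<open>v + V\<^sub>G v = F\<close> for the density \<open>v\<close>.
  The boundary-extended derivatives read \<open>P\<close> and \<open>v\<close> off \<open>u\<close>, so each term of the equation is either a
  known function of \<open>P\<close>, which goes into \<open>F\<close>, or a Volterra operator applied to \<open>v\<close>; by Fubini
  \<open>V\<^sub>K R\<close> is again a Volterra operator, and the kernels add up to \<open>G\<close>
  (\<open>satisfies_equation_iff_volterra\<close>). As \<open>P\<close> enters only \<open>F\<close>, the kernel does not depend on the jet.

  The Volterra equation is solved by the Neumann series. All kernels satisfy
  \<open>|G(t,s)| \<le> C (t - s)\<^bsup>\<eta>-1\<^esup>\<close>, and the Beta integral shows that composing two such kernels adds the
  exponents \<open>\<eta>\<close>. Hence the \<open>n\<close>-fold iterate has exponent \<open>n\<eta>\<close> and the constant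
  \<open>(C \<Gamma>(\<eta>))\<^bsup>n\<^esup> / \<Gamma>(n\<eta>)\<close>, which decays faster than any geometric sequence. This gives convergence
  to a solution (\<open>resolvent_solves_volterra\<close>) and uniqueness (\<open>volterra_homogeneous_unique\<close>).

  It remains to see that \<open>u\<close> determines \<open>P\<close> and \<open>v\<close> and has the right jet. The Prabhakar
  kernel is a series of Riemann-Liouville kernels \<open>x\<^bsup>\<rho>n+\<mu>-1\<^esup> / \<Gamma>(\<rho>n+\<mu>)\<close>, so fractional
  integration of order \<open>\<alpha>\<close> just replaces \<open>\<mu>\<close> by \<open>\<mu> + \<alpha>\<close> (\<open>volterra_rl_ml_kernel\<close>). With
  \<open>\<alpha> = 1\<close> this says that differentiating \<open>R v\<close> lowers \<open>\<mu>\<close> by one. As \<open>\<mu> > m - 1\<close>, one may do so \<open>m - 1\<close>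
  times, and the results are Volterra integrals, which vanish at \<open>0\<close>; the jet of \<open>u\<close> is thus that of \<open>P\<close>.
  For injectivity of \<open>R\<close>, integrate \<open>R v = 0\<close> up to an integer order \<open>\<mu>\<close> and differentiate
  down to \<open>\<mu> = 1\<close>; one more derivative gives \<open>v + V\<^sub>Q v = 0\<close> with a weakly singular kernel \<open>Q\<close>, and
  so \<open>v = 0\<close> by uniqueness for Volterra equations (\<open>volterra_ml_injective\<close>).
\<close>

section \<open>Beta integrals\<close>

lemma lborel_finite_difference:
  fixes f g :: "real \<Rightarrow> 'a::{banach, second_countable_topology}"
  assumes "finite X" "\<And>x. x \<notin> X \<Longrightarrow> f x = g x"
  shows "integral\<^sup>L lborel f = integral\<^sup>L lborel g" "integrable lborel f \<longleftrightarrow> integrable lborel g"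
  using assms
  by (intro integral_discrete_difference[where X=X] integrable_discrete_difference[where X=X];
      simp add: countable_finite)+

lemma integrable_if_bounded_by:
  fixes f :: "'a \<Rightarrow> 'b::{banach, second_countable_topology}" and g :: "'a \<Rightarrow> real"
  assumes "integrable M g" "f \<in> borel_measurable M" "\<And>x. norm (f x) \<le> g x"
  shows "integrable M f"
  using assms(1,2) by (rule Bochner_Integration.integrable_bound)
    (auto intro: order_trans[OF assms(3) abs_ge_self])

lemma has_bochner_integral_Beta_unit:
  assumes "a > 0" "b > (0::real)"
  shows "has_bochner_integral lborel
           (\<lambda>x. indicator {0..1} x * (x powr (a - 1) * (1 - x) powr (b - 1))) (Beta a b)"
proof -
  let ?f = "\<lambda>x::real. x powr (a - 1) * (1 - x) powr (b - 1)"
  have hi: "(?f has_integral Beta a b) {0..1}"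
    using has_integral_Beta_real[OF assms] .
  have ab: "?f absolutely_integrable_on {0..1}"
    by (rule nonnegative_absolutely_integrable_1) (use hi in \<open>auto simp: integrable_on_def\<close>)
  then have "integrable lborel (\<lambda>x. indicator {0..1} x *\<^sub>R ?f x)"
    unfolding set_integrable_def
    by (subst (asm) integrable_completion) measurable
  then have si: "set_integrable lborel {0..1} ?f"
    unfolding set_integrable_def .
  have "(LINT x:{0..1}|lborel. ?f x) = Beta a b"
    using set_borel_integral_eq_integral(2)[OF si] hi by (simp add: integral_unique)
  then show ?thesis
    using si unfolding set_integrable_def set_lebesgue_integral_def has_bochner_integral_iff by simp
qed

text \<open>
  The affine map of \<open>{0..1}\<close> onto \<open>{s..t}\<close> turns the Beta integral into the convolution of two powers:
  the exponents, counted as \<open>a\<close> in \<open>x powr (a - 1)\<close>, add up.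
\<close>

lemma has_bochner_integral_Beta_interval:
  assumes "a > 0" "b > (0::real)" "s < t"
  shows "has_bochner_integral lborel
           (\<lambda>x. indicator {s<..<t} x * ((t - x) powr (a - 1) * (x - s) powr (b - 1)))
           (Beta a b * (t - s) powr (a + b - 1))"
proof -
  define g where "g = (\<lambda>x. indicator {s<..<t} x * ((t - x) powr (a - 1) * (x - s) powr (b - 1)))"
  let ?h = "\<lambda>x. indicator {0..1} x * (x powr (b - 1) * (1 - x) powr (a - 1))"
  have eq: "g (s + (t - s) * x) = (t - s) powr (a + b - 2) * ?h x" if "x \<notin> {0,1}" for x
  proof (cases "0 < x \<and> x < 1")
    case True
    have *: "t - (s + (t - s) * x) = (t - s) * (1 - x)" by (simp add: algebra_simps)
    have **: "(t - s) powr (a + b - 2) = (t - s) powr (a - 1) * (t - s) powr (b - 1)"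
      by (simp add: powr_add[symmetric])
    have "s < s + (t - s) * x" "s + (t - s) * x < t"
      using True assms by (auto simp: mult_less_cancel_left2 algebra_simps less_diff_eq)
        (smt (verit, ccfv_SIG) mult_less_cancel_left2 mult.commute ring_class.ring_distribs)
    then show ?thesis
      using True assms unfolding g_def * **
      by (simp add: powr_mult del: left_diff_distrib)
  next
    case False
    have "\<not> (s < s + (t - s) * x \<and> s + (t - s) * x < t)"
    proof
      assume A: "s < s + (t - s) * x \<and> s + (t - s) * x < t"
      then have "x > 0" using assms by (simp add: zero_less_mult_iff)
      moreover have "(t - s) * x < (t - s) * 1" using A unfolding mult_1_right by linarith
      then have "x < 1" by (rule mult_left_less_imp_less) (use assms in simp)
      ultimately show False using False by simp
    qed
    moreover have "x \<notin> {0..1}" using False that by auto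
    ultimately show ?thesis unfolding g_def by (auto simp: indicator_def)
  qed
  have h: "has_bochner_integral lborel (\<lambda>x. (t - s) powr (a + b - 2) * ?h x)
          ((t - s) powr (a + b - 2) * Beta b a)"
    by (intro has_bochner_integral_mult_right has_bochner_integral_Beta_unit assms)
  have "has_bochner_integral lborel (\<lambda>x. g (s + (t - s) * x))
          ((t - s) powr (a + b - 2) * Beta b a)"
    using h lborel_finite_difference[of "{0,1}" "\<lambda>x. g (s + (t - s) * x)"
        "\<lambda>x. (t - s) powr (a + b - 2) * ?h x"] eq
    unfolding has_bochner_integral_iff by auto
  moreover have "(t - s) powr (a + b - 2) * Beta b a
       = (Beta a b * (t - s) powr (a + b - 1)) /\<^sub>R \<bar>t - s\<bar>"
  proof -
    have "(t - s) powr (a + b - 1) = (t - s) powr (a + b - 2) * (t - s)"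
      using assms powr_add[of "t - s" "a + b - 2" 1] by simp
    then show ?thesis using assms by (simp add: Beta_commute[of a b])
  qed
  ultimately have "has_bochner_integral lborel g (Beta a b * (t - s) powr (a + b - 1))"
    using assms by (subst lborel_has_bochner_integral_real_affine_iff[of "t - s" _ _ s]) simp_all
  then show ?thesis unfolding g_def .
qed

lemma has_bochner_integral_powr_interval:
  assumes "a > 0" "s < (t::real)"
  shows "has_bochner_integral lborel (\<lambda>x. indicator {s<..<t} x * (t - x) powr (a - 1))
           ((t - s) powr a / a)"
proof -
  have "Beta a 1 = 1 / a"
    using assms by (simp add: Beta_def Gamma_plus1 Gamma_eq_zero_iff nonpos_Ints_def)
  moreover have "(\<lambda>x. indicator {s<..<t} x * ((t - x) powr (a - 1) * (x - s) powr (1 - 1)))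
      = (\<lambda>x. indicator {s<..<t} x * (t - x) powr (a - 1))"
    by (auto simp: fun_eq_iff indicator_def)
  ultimately show ?thesis
    using has_bochner_integral_Beta_interval[of a 1 s t] assms by simp
qed

section \<open>Weakly singular Volterra kernels\<close>

text \<open>
  The kernel on the open triangle, extended by zero to the plane. With it Volterra integrals and
  kernel compositions become integrals over the whole line, to which Fubini applies directly;
  the diagonal is left out because the bounds on the kernels blow up there.
\<close>

definition cut :: "real \<Rightarrow> (real \<Rightarrow> real \<Rightarrow> complex) \<Rightarrow> real \<Rightarrow> real \<Rightarrow> complex" where
  "cut T G t s = (if 0 \<le> s \<and> s < t \<and> t \<le> T then G t s else 0)"

lemma volterra_eq_cut:
  assumes "0 \<le> t" "t \<le> T"
  shows "volterra G f t = (LINT s|lborel. cut T G t s * f s)"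
  unfolding volterra_def set_lebesgue_integral_def
  by (rule lborel_finite_difference[of "{t}"])
     (use assms in \<open>auto simp: cut_def indicator_def\<close>)

lemma volterra_cong:
  assumes "\<And>s. 0 \<le> s \<Longrightarrow> s < t \<Longrightarrow> G t s = H t s" "\<And>s. 0 \<le> s \<Longrightarrow> s < t \<Longrightarrow> f s = g s"
  shows "volterra G f t = volterra H g t"
  unfolding volterra_def set_lebesgue_integral_def
  by (rule lborel_finite_difference[of "{t}"])
     (use assms in \<open>auto simp: indicator_def\<close>)

text \<open>
  The bound is required everywhere on the triangle and not only almost everywhere, so that it passes
  to the iterated kernels without discussing exceptional sets.
\<close>

definition weakly_singular :: "real \<Rightarrow> real \<Rightarrow> real \<Rightarrow> (real \<Rightarrow> real \<Rightarrow> complex) \<Rightarrow> bool" where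
  "weakly_singular T \<eta> C G \<longleftrightarrow> \<eta> > 0 \<and> C \<ge> 0 \<and>
     case_prod (cut T G) \<in> borel_measurable (borel \<Otimes>\<^sub>M borel) \<and>
     (\<forall>t s. 0 \<le> s \<longrightarrow> s < t \<longrightarrow> t \<le> T \<longrightarrow> norm (G t s) \<le> C * (t - s) powr (\<eta> - 1))"

text \<open>
  The last bound holds on the whole line: the point \<open>s = 0\<close>, which belongs to the triangle but not to the
  open interval, gets a term of its own.
\<close>

lemma weakly_singularD:
  assumes "weakly_singular T \<eta> C G"
  shows "\<eta> > 0" "C \<ge> 0" "case_prod (cut T G) \<in> borel_measurable (borel \<Otimes>\<^sub>M borel)"
    "\<And>t s. 0 \<le> s \<Longrightarrow> s < t \<Longrightarrow> t \<le> T \<Longrightarrow> norm (G t s) \<le> C * (t - s) powr (\<eta> - 1)"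
    "\<And>t. cut T G t \<in> borel_measurable borel"
    "\<And>t s. norm (cut T G t s) \<le> C * (indicator {0<..<t} s * (t - s) powr (\<eta> - 1)
              + indicator {0} s * \<bar>t\<bar> powr (\<eta> - 1))"
proof -
  show 1: "\<eta> > 0" "C \<ge> 0" "case_prod (cut T G) \<in> borel_measurable (borel \<Otimes>\<^sub>M borel)"
    "\<And>t s. 0 \<le> s \<Longrightarrow> s < t \<Longrightarrow> t \<le> T \<Longrightarrow> norm (G t s) \<le> C * (t - s) powr (\<eta> - 1)"
    using assms unfolding weakly_singular_def by auto
  show "cut T G t \<in> borel_measurable borel" for t
    using 1(3) measurable_compose[OF measurable_Pair1', of t borel "case_prod (cut T G)" borel borel]
    by simp
  show "norm (cut T G t s) \<le> C * (indicator {0<..<t} s * (t - s) powr (\<eta> - 1)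
              + indicator {0} s * \<bar>t\<bar> powr (\<eta> - 1))" for t s
    using 1(4)[of s t] 1(2) by (auto simp: cut_def indicator_def)
qed

lemma cut_section_integrable:
  assumes G: "weakly_singular T \<eta> C G"
  shows "integrable lborel (cut T G t)"
    and "0 \<le> t \<Longrightarrow> t \<le> T \<Longrightarrow> (LINT s|lborel. norm (cut T G t s)) \<le> C * T powr \<eta> / \<eta>"
proof -
  note D = weakly_singularD[OF G]
  have "integrable lborel (cut T G t) \<and>
    (0 \<le> t \<longrightarrow> t \<le> T \<longrightarrow> (LINT s|lborel. norm (cut T G t s)) \<le> C * T powr \<eta> / \<eta>)"
  proof (cases "0 < t")
    case False
    then have "cut T G t = (\<lambda>_. 0)" by (auto simp: cut_def fun_eq_iff)
    then show ?thesis using D(1,2) by auto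
  next
    case True
    let ?b = "\<lambda>s. C * (indicator {0<..<t} s * (t - s) powr (\<eta> - 1)
              + indicator {0} s * \<bar>t\<bar> powr (\<eta> - 1))"
    let ?b' = "\<lambda>s. C * (indicator {0<..<t} s * (t - s) powr (\<eta> - 1))"
    have "has_bochner_integral lborel ?b' (C * (t powr \<eta> / \<eta>))"
      using has_bochner_integral_powr_interval[OF D(1) True]
      by (intro has_bochner_integral_mult_right) simp
    then have b: "integrable lborel ?b" "integral\<^sup>L lborel ?b = C * (t powr \<eta> / \<eta>)"
      using lborel_finite_difference[of "{0}" ?b ?b']
      by (auto simp: has_bochner_integral_iff)
    have i: "integrable lborel (cut T G t)"
      by (rule integrable_if_bounded_by[OF b(1)]) (use D(5,6) in auto)
    have "(LINT s|lborel. norm (cut T G t s)) \<le> integral\<^sup>L lborel ?b"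
      by (rule integral_mono) (use i b D(6) in auto)
    also have "\<dots> \<le> C * (T powr \<eta> / \<eta>)" if "t \<le> T"
      unfolding b(2) using D(1,2) True that
      by (intro mult_left_mono divide_right_mono powr_mono2) auto
    finally show ?thesis using i by auto
  qed
  then show "integrable lborel (cut T G t)"
    "0 \<le> t \<Longrightarrow> t \<le> T \<Longrightarrow> (LINT s|lborel. norm (cut T G t s)) \<le> C * T powr \<eta> / \<eta>" by auto
qed

lemma continuous_on_bounded_measurable:
  fixes f :: "real \<Rightarrow> complex"
  assumes "continuous_on {0..T} f"
  shows "(\<lambda>s. indicator {0..T} s *\<^sub>R f s) \<in> borel_measurable borel"
    "\<exists>M\<ge>0. \<forall>s\<in>{0..T}. norm (f s) \<le> M"
proof -
  show "(\<lambda>s. indicator {0..T} s *\<^sub>R f s) \<in> borel_measurable borel"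
    using assms by (intro borel_measurable_continuous_on_indicator) auto
  have "bounded (f ` {0..T})"
    by (intro compact_imp_bounded compact_continuous_image assms) auto
  then obtain M where "\<forall>s\<in>{0..T}. norm (f s) \<le> M" by (auto simp: bounded_iff)
  then show "\<exists>M\<ge>0. \<forall>s\<in>{0..T}. norm (f s) \<le> M"
    by (intro exI[of _ "max M 0"]) (auto intro: le_max_iff_disj[THEN iffD2])
qed

lemma cut_mult_extension: "cut T G t s * f s = cut T G t s * (indicator {0..T} s *\<^sub>R f s)"
  by (auto simp: cut_def)

lemma cut_mult_integrable:
  assumes G: "weakly_singular T \<eta> C G" and f: "continuous_on {0..T} f"
  shows "integrable lborel (\<lambda>s. cut T G t s * f s)"
    and "0 \<le> t \<Longrightarrow> t \<le> T \<Longrightarrow> M \<ge> 0 \<Longrightarrow> (\<And>s. s \<in> {0..T} \<Longrightarrow> norm (f s) \<le> M)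
          \<Longrightarrow> (LINT s|lborel. norm (cut T G t s * f s)) \<le> M * (C * T powr \<eta> / \<eta>)"
proof -
  note D = weakly_singularD[OF G]
  note fm = continuous_on_bounded_measurable(1)[OF f]
  have bd: "norm (cut T G t s * f s) \<le> M * norm (cut T G t s)"
    if "\<forall>s\<in>{0..T}. norm (f s) \<le> M" for M s
    using that[rule_format, of s] mult_left_mono[of "norm (f s)" M "norm (G t s)"]
    by (auto simp: cut_def norm_mult mult.commute)
  have m: "(\<lambda>s. cut T G t s * f s) \<in> borel_measurable borel"
    unfolding cut_mult_extension[of T G t _ f] using D(5)[of t] fm by (rule borel_measurable_times)
  obtain M where M: "M \<ge> 0" "\<forall>s\<in>{0..T}. norm (f s) \<le> M"
    using continuous_on_bounded_measurable(2)[OF f] by blast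
  show i: "integrable lborel (\<lambda>s. cut T G t s * f s)"
    by (rule Bochner_Integration.integrable_bound[where f="\<lambda>s. M * norm (cut T G t s)"])
       (use m bd[OF M(2)] cut_section_integrable(1)[OF G] M(1) in auto)
  show "(LINT s|lborel. norm (cut T G t s * f s)) \<le> M * (C * T powr \<eta> / \<eta>)"
    if t: "0 \<le> t" "t \<le> T" and M: "M \<ge> 0" "\<And>s. s \<in> {0..T} \<Longrightarrow> norm (f s) \<le> M" for M
  proof -
  have "(LINT s|lborel. norm (cut T G t s * f s)) \<le> (LINT s|lborel. M * norm (cut T G t s))"
    by (rule integral_mono) (use i bd M cut_section_integrable(1)[OF G] in auto)
  also have "\<dots> \<le> M * (C * T powr \<eta> / \<eta>)"
    using mult_left_mono[OF cut_section_integrable(2)[OF G t] M(1)] by simp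
  finally show ?thesis .
  qed
qed

lemma volterra_bound:
  assumes G: "weakly_singular T \<eta> C G" and f: "continuous_on {0..T} f"
    and "0 \<le> t" "t \<le> T" "M \<ge> 0" "\<And>s. s \<in> {0..T} \<Longrightarrow> norm (f s) \<le> M"
  shows "norm (volterra G f t) \<le> M * (C * T powr \<eta> / \<eta>)"
  unfolding volterra_eq_cut[OF assms(3,4)]
  by (rule order_trans[OF integral_norm_bound cut_mult_integrable(2)[OF G f assms(3-)]])

text \<open>The kernel of the composite Volterra operator, and the step by which iterated kernels are formed.\<close>

definition kernel_comp ::
  "(real \<Rightarrow> real \<Rightarrow> complex) \<Rightarrow> (real \<Rightarrow> real \<Rightarrow> complex) \<Rightarrow> real \<Rightarrow> real \<Rightarrow> complex" where
  "kernel_comp A B t s = (LINT \<xi>:{s..t}|lborel. A t \<xi> * B \<xi> s)"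

text \<open>
  If \<open>(t, s)\<close> lies outside the triangle, no \<open>\<xi>\<close> satisfies both \<open>s < \<xi>\<close> and \<open>\<xi> < t \<le> T\<close>, so the identity
  holds without restriction and measurability of the composite is that of a parametrised integral.
\<close>

lemma cut_kernel_comp:
  "cut T (kernel_comp A B) t s = (LINT \<xi>|lborel. cut T A t \<xi> * cut T B \<xi> s)"
proof (cases "0 \<le> s \<and> s < t \<and> t \<le> T")
  case True
  then show ?thesis
    unfolding kernel_comp_def set_lebesgue_integral_def cut_def[of T "\<lambda>t s. _ t s" t s]
    by (simp, intro lborel_finite_difference[of "{s,t}"])
       (auto simp: cut_def indicator_def)
next
  case False
  then have "(\<lambda>\<xi>. cut T A t \<xi> * cut T B \<xi> s) = (\<lambda>_. 0)"
    by (auto simp: cut_def fun_eq_iff)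
  then have "(LINT \<xi>|lborel. cut T A t \<xi> * cut T B \<xi> s) = 0" by simp
  with False show ?thesis by (auto simp: cut_def[of T "kernel_comp A B"])
qed

text \<open>
  The bound is the convolution of two powers. That the exponents add is what makes the
  Neumann series converge without any smallness assumption.
\<close>

lemma weakly_singular_kernel_comp:
  assumes A: "weakly_singular T \<alpha> C A" and B: "weakly_singular T \<beta> D B"
  shows "weakly_singular T (\<alpha> + \<beta>) (C * D * Beta \<alpha> \<beta>) (kernel_comp A B)"
proof -
  note a = weakly_singularD[OF A] and b = weakly_singularD[OF B]
  have pos: "Beta \<alpha> \<beta> \<ge> 0"
    using a(1) b(1) by (auto simp: Beta_def intro!: divide_nonneg_nonneg mult_nonneg_nonneg Gamma_real_nonneg)
  note [measurable] = a(3) b(3)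
  have [measurable]: "(\<lambda>(x, \<xi>). cut T A (fst x) \<xi> * cut T B \<xi> (snd x))
        \<in> borel_measurable ((borel \<Otimes>\<^sub>M borel) \<Otimes>\<^sub>M lborel)"
    by measurable
  have "(\<lambda>x. LINT \<xi>|lborel. cut T A (fst x) \<xi> * cut T B \<xi> (snd x))
          \<in> borel_measurable (borel \<Otimes>\<^sub>M borel)"
    by measurable
  then have m: "case_prod (cut T (kernel_comp A B)) \<in> borel_measurable (borel \<Otimes>\<^sub>M borel)"
    by (simp add: cut_kernel_comp[abs_def] case_prod_unfold)
  have "norm (kernel_comp A B t s) \<le> C * D * Beta \<alpha> \<beta> * (t - s) powr (\<alpha> + \<beta> - 1)"
    if st: "0 \<le> s" "s < t" "t \<le> T" for t s
  proof -
    let ?g = "\<lambda>x. C * D * (indicator {s<..<t} x * ((t - x) powr (\<alpha> - 1) * (x - s) powr (\<beta> - 1)))"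
    have g: "has_bochner_integral lborel ?g (C * D * (Beta \<alpha> \<beta> * (t - s) powr (\<alpha> + \<beta> - 1)))"
      by (intro has_bochner_integral_mult_right has_bochner_integral_Beta_interval a b st)
    have le: "norm (cut T A t x * cut T B x s) \<le> ?g x" for x
    proof (cases "s < x \<and> x < t")
      case True
      then have "norm (A t x) * norm (B x s)
        \<le> (C * (t - x) powr (\<alpha> - 1)) * (D * (x - s) powr (\<beta> - 1))"
        using st a(2) b(2) by (intro mult_mono a(4) b(4)) auto
      with True st show ?thesis by (simp add: cut_def norm_mult mult_ac)
    qed (use st in \<open>auto simp: cut_def\<close>)
    have "norm (kernel_comp A B t s) = norm (LINT x|lborel. cut T A t x * cut T B x s)"
      using st cut_kernel_comp[of T A B t s] by (simp add: cut_def)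
    also have "\<dots> \<le> integral\<^sup>L lborel ?g"
    proof (rule order_trans[OF integral_norm_bound], rule integral_mono)
      have "(\<lambda>x. cut T A t x * cut T B x s) \<in> borel_measurable lborel" by measurable
      moreover show "integrable lborel ?g" using g by (simp add: has_bochner_integral_iff)
      ultimately show "integrable lborel (\<lambda>x. norm (cut T A t x * cut T B x s))"
        using le by (intro integrable_norm) (rule integrable_if_bounded_by)
    qed (rule le)
    finally show ?thesis
      unfolding has_bochner_integral_integral_eq[OF g] by (simp only: mult.assoc)
  qed
  then show ?thesis
    unfolding weakly_singular_def using a b pos m by auto
qed

text \<open>
  Fubini on the triangle. This single identity yields the iterates of a Volterra operator, the
  absorption of \<open>V\<^sub>K R\<close> into the reduced kernel, and the fractional integration of Mittag-Leffler kernels.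
\<close>

lemma volterra_kernel_comp:
  assumes A: "weakly_singular T \<alpha> C A" and B: "weakly_singular T \<beta> D B"
    and f: "continuous_on {0..T} f" and t: "0 \<le> t" "t \<le> T"
  shows "volterra (kernel_comp A B) f t = volterra A (volterra B f) t"
proof -
  note a = weakly_singularD[OF A] and b = weakly_singularD[OF B]
  note f1 = continuous_on_bounded_measurable(1)[OF f]
  define f0 where "f0 = (\<lambda>s. indicator {0..T} s *\<^sub>R f s)"
  have f0[measurable]: "f0 \<in> borel_measurable borel" using f1 by (simp add: f0_def)
  obtain M where M: "M \<ge> 0" "\<forall>s\<in>{0..T}. norm (f s) \<le> M"
    using continuous_on_bounded_measurable(2)[OF f] by blast
  note [measurable] = a(3) b(3) a(5)
  let ?h = "\<lambda>x s. cut T A t x * (cut T B x s * f0 s)"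
  have f0B: "cut T B x s * f0 s = cut T B x s * f s" for x s
    by (auto simp: f0_def cut_def)
  have m: "case_prod ?h \<in> borel_measurable (lborel \<Otimes>\<^sub>M lborel)" by measurable
  have m2: "(\<lambda>x. LINT s|lborel. norm (?h x s)) \<in> borel_measurable lborel" by measurable
  have hi: "integrable lborel (?h x)" for x
    unfolding f0B using cut_mult_integrable(1)[OF B f] by (intro integrable_mult_right)
  have le: "(LINT s|lborel. norm (?h x s)) \<le> M * (D * T powr \<beta> / \<beta>) * norm (cut T A t x)" for x
  proof (cases "0 \<le> x \<and> x < t")
    case True
    have "(LINT s|lborel. norm (?h x s)) = norm (cut T A t x) * (LINT s|lborel. norm (cut T B x s * f s))"
      unfolding f0B norm_mult[of "cut T A t x"] by simp
    also have "\<dots> \<le> norm (cut T A t x) * (M * (D * T powr \<beta> / \<beta>))"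
      by (intro mult_left_mono cut_mult_integrable(2)[OF B f]) (use True t M in auto)
    finally show ?thesis by (simp add: mult_ac)
  qed (auto simp: cut_def)
  have "integrable (lborel \<Otimes>\<^sub>M lborel) (case_prod ?h)"
  proof (rule lborel_pair.Fubini_integrable[OF m])
    show "integrable lborel (\<lambda>x. LINT s|lborel. norm (case_prod ?h (x, s)))"
      by (rule Bochner_Integration.integrable_bound
          [where f="\<lambda>x. M * (D * T powr \<beta> / \<beta>) * norm (cut T A t x)"])
         (use m2 le cut_section_integrable(1)[OF A] M b(1,2) in
            \<open>auto simp: abs_of_nonneg integral_nonneg_AE abs_mult\<close>)
  qed (use hi in auto)
  then have "(LINT s|lborel. LINT x|lborel. ?h x s) = (LINT x|lborel. LINT s|lborel. ?h x s)"
    by (rule lborel_pair.Fubini_integral)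
  moreover have "(LINT x|lborel. LINT s|lborel. ?h x s) = volterra A (volterra B f) t"
    unfolding volterra_eq_cut[OF t]
  proof (rule Bochner_Integration.integral_cong[OF refl])
    fix x
    show "(LINT s|lborel. ?h x s) = cut T A t x * volterra B f x"
      unfolding f0B by (cases "0 \<le> x \<and> x \<le> T") (auto simp: volterra_eq_cut[of x T] cut_def)
  qed
  moreover have "(LINT s|lborel. LINT x|lborel. ?h x s) = volterra (kernel_comp A B) f t"
    unfolding volterra_eq_cut[OF t] cut_kernel_comp
  proof (rule Bochner_Integration.integral_cong[OF refl])
    fix s
    have "?h x s = (cut T A t x * cut T B x s) * f s" for x
      unfolding f0B by simp
    then have "(LINT x|lborel. ?h x s) = (LINT x|lborel. (cut T A t x * cut T B x s) * f s)"
      by presburger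
    then show "(LINT x|lborel. ?h x s) = (LINT x|lborel. cut T A t x * cut T B x s) * f s" by simp
  qed
  ultimately show ?thesis by simp
qed

section \<open>The resolvent of a Volterra operator\<close>

text \<open>
  Logarithmic convexity: the slope of \<open>ln \<Gamma>\<close> over \<open>[x, x + r]\<close> is at least its slope over
  \<open>[x - 1, x]\<close>, which is \<open>ln (x - 1)\<close> by the functional equation.
\<close>

lemma Gamma_growth:
  assumes "x > 1" "r > (0::real)"
  shows "Gamma (x + r) \<ge> (x - 1) powr r * Gamma x"
proof -
  let ?L = "ln \<circ> (Gamma :: real \<Rightarrow> real)"
  have pos: "Gamma (x - 1) > 0" "Gamma x > 0" "Gamma (x + r) > 0"
    using assms by (auto intro!: Gamma_real_pos)
  have e: "(1 - 1 / (1 + r)) *\<^sub>R (x - 1) + (1 / (1 + r)) *\<^sub>R (x + r) = x"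
  proof -
    define k where "k = 1 / (1 + r)"
    have "k * (1 + r) = 1" using assms by (simp add: k_def)
    moreover have "(1 - k) * (x - 1) + k * (x + r) = x - 1 + k * (1 + r)"
      by (simp add: algebra_simps)
    ultimately show ?thesis by (simp add: k_def)
  qed
  have "?L x \<le> (1 - 1 / (1 + r)) * ?L (x - 1) + (1 / (1 + r)) * ?L (x + r)"
    using convex_onD[OF log_convex_Gamma_real, of "1 / (1 + r)" "x - 1" "x + r"] assms
    unfolding e by simp
  then have "(1 + r) * ?L x \<le> (1 + r) * ((1 - 1 / (1 + r)) * ?L (x - 1) + (1 / (1 + r)) * ?L (x + r))"
    using assms by (intro mult_left_mono) auto
  also have "\<dots> = r * ?L (x - 1) + ?L (x + r)"
  proof -
    define k where "k = 1 / (1 + r)"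
    have k: "k * (1 + r) = 1" using assms by (simp add: k_def)
    have "(1 + r) * ((1 - k) * l + k * l') = r * l + l'" for l l'
    proof -
      have "(1 + r) * ((1 - k) * l + k * l') = (1 + r) * l - (k * (1 + r)) * l + (k * (1 + r)) * l'"
        by (simp add: algebra_simps)
      also have "\<dots> = r * l + l'" unfolding k by (simp add: algebra_simps)
      finally show ?thesis .
    qed
    then show ?thesis unfolding k_def .
  qed
  finally have 1: "(1 + r) * ln (Gamma x) \<le> r * ln (Gamma (x - 1)) + ln (Gamma (x + r))" by simp
  have "Gamma x = (x - 1) * Gamma (x - 1)"
    using Gamma_plus1[of "x - 1"] assms by (auto simp: nonpos_Ints_def)
  then have "ln (Gamma x) = ln ((x - 1) * Gamma (x - 1))" by (rule arg_cong)
  also have "\<dots> = ln (x - 1) + ln (Gamma (x - 1))"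
    by (rule ln_mult_pos) (use assms pos in auto)
  finally have "ln (Gamma x) = ln (x - 1) + ln (Gamma (x - 1))" .
  with 1 have "r * ln (x - 1) + ln (Gamma x) \<le> ln (Gamma (x + r))"
    by (simp add: algebra_simps)
  then have "exp (r * ln (x - 1) + ln (Gamma x)) \<le> Gamma (x + r)"
    using pos by (metis exp_le_cancel_iff exp_ln)
  then show ?thesis using assms pos by (simp add: exp_add powr_def)
qed

lemma summable_power_over_Gamma:
  assumes "\<rho> > 0" "a > 0" "B \<ge> (0::real)"
  shows "summable (\<lambda>n. B ^ n / Gamma (\<rho> * real n + a))"
proof -
  \<comment> \<open>From this index on, \<open>y = \<rho>n + a\<close> satisfies \<open>(y - 1) powr \<rho> \<ge> 2B\<close>, so the terms at least halve.\<close>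
  obtain N :: nat where N: "((2 * B + 1) powr (1 / \<rho>) + 1) / \<rho> < real N"
    using reals_Archimedean2 by blast
  show ?thesis
  proof (rule summable_ratio_test[of "1/2" N])
    fix n assume "N \<le> n"
    define y where "y = \<rho> * real n + a"
    have "((2 * B + 1) powr (1 / \<rho>) + 1) / \<rho> < real n" using N \<open>N \<le> n\<close> by linarith
    then have "(2 * B + 1) powr (1 / \<rho>) + 1 < \<rho> * real n"
      using assms by (simp add: field_simps)
    then have y: "(2 * B + 1) powr (1 / \<rho>) < y - 1" using assms by (simp add: y_def)
    have y1: "y > 1" using y powr_ge_zero[of "2 * B + 1" "1/\<rho>"] by linarith
    have "2 * B + 1 = ((2 * B + 1) powr (1 / \<rho>)) powr \<rho>"
      using assms by (simp add: powr_powr)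
    also have "\<dots> \<le> (y - 1) powr \<rho>" using y assms by (intro powr_mono2) auto
    finally have "2 * B \<le> (y - 1) powr \<rho>" by simp
    then have "2 * B * Gamma y \<le> (y - 1) powr \<rho> * Gamma y"
      using y1 by (intro mult_right_mono Gamma_real_nonneg) auto
    also have "\<dots> \<le> Gamma (y + \<rho>)" using Gamma_growth[OF y1] assms by simp
    finally have *: "2 * B * Gamma y \<le> Gamma (y + \<rho>)" .
    have pos: "Gamma y > 0" "Gamma (y + \<rho>) > 0" using y1 assms by (auto intro!: Gamma_real_pos)
    have "\<rho> * real (Suc n) + a = y + \<rho>" by (simp add: y_def algebra_simps)
    moreover have "B * B ^ n / Gamma (y + \<rho>) \<le> 1 / 2 * (B ^ n / Gamma y)"
      using mult_left_mono[OF *, of "B ^ n"] pos assms by (simp add: field_simps)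
    ultimately show "norm (B ^ Suc n / Gamma (\<rho> * real (Suc n) + a))
        \<le> 1 / 2 * norm (B ^ n / Gamma (\<rho> * real n + a))"
      using pos assms by (simp add: y_def[symmetric] abs_of_pos)
  qed simp
qed

text \<open>The Beta functions produced by the successive compositions telescope.\<close>

lemma weakly_singular_iter_kernel:
  assumes G: "weakly_singular T \<eta> C G"
  shows "weakly_singular T (\<eta> * real n + \<eta>) ((C * Gamma \<eta>) ^ Suc n / Gamma (\<eta> * real n + \<eta>))
           (iter_kernel G n)"
proof (induction n)
  case 0
  have "Gamma \<eta> > 0" using weakly_singularD(1)[OF G] by (rule Gamma_real_pos)
  then show ?case using G by simp
next
  case (Suc n)
  have \<eta>: "\<eta> > 0" using weakly_singularD(1)[OF G] .
  have pos: "Gamma (\<eta> * real n + \<eta>) > 0" using \<eta> by (intro Gamma_real_pos add_nonneg_pos) auto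
  have e: "iter_kernel G (Suc n) = kernel_comp G (iter_kernel G n)"
    by (simp add: kernel_comp_def fun_eq_iff)
  have "C * ((C * Gamma \<eta>) ^ Suc n / Gamma (\<eta> * real n + \<eta>)) * Beta \<eta> (\<eta> * real n + \<eta>)
      = (C * Gamma \<eta>) ^ Suc (Suc n) / Gamma (\<eta> * real (Suc n) + \<eta>)"
    using pos by (simp add: Beta_def algebra_simps)
  moreover have "\<eta> + (\<eta> * real n + \<eta>) = \<eta> * real (Suc n) + \<eta>" by (simp add: algebra_simps)
  ultimately show ?case
    using weakly_singular_kernel_comp[OF G Suc] unfolding e by (simp only:)
qed

text \<open>
  The summable sequence dominates the operator norms of all iterates on the interval; the last line
  is in the form in which \<open>volterra_bound\<close> produces the estimate.
\<close>

lemma iter_kernel_bounds: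
  assumes G: "weakly_singular T \<eta> C G" and T: "T > 0"
  obtains b where "summable b" "\<And>n. b n \<ge> 0"
    "\<And>n. weakly_singular T (\<eta> * real n + \<eta>) ((C * Gamma \<eta>) ^ Suc n / Gamma (\<eta> * real n + \<eta>))
           (iter_kernel G n)"
    "\<And>n. (C * Gamma \<eta>) ^ Suc n / Gamma (\<eta> * real n + \<eta>) * T powr (\<eta> * real n + \<eta>) / (\<eta> * real n + \<eta>) \<le> b n"
proof -
  note D = weakly_singularD[OF G]
  define q where "q = C * Gamma \<eta> * T powr \<eta>"
  have q: "q \<ge> 0" using D Gamma_real_nonneg[of \<eta>] by (auto simp: q_def)
  define b where "b = (\<lambda>n. q / \<eta> * (q ^ n / Gamma (\<eta> * real n + \<eta>)))"
  have pos: "Gamma (\<eta> * real n + \<eta>) > 0" for n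
    using D(1) by (intro Gamma_real_pos add_nonneg_pos) auto
  have "summable b"
    unfolding b_def by (intro summable_mult summable_power_over_Gamma D q)
  moreover have "b n \<ge> 0" for n
    unfolding b_def using q D(1) pos[of n] by auto
  moreover have "(C * Gamma \<eta>) ^ Suc n / Gamma (\<eta> * real n + \<eta>) * T powr (\<eta> * real n + \<eta>) / (\<eta> * real n + \<eta>) \<le> b n" for n
  proof -
    have "T powr (\<eta> * real n + \<eta>) = (T powr \<eta>) powr (real (Suc n))"
      unfolding powr_powr by (simp add: algebra_simps)
    also have "\<dots> = (T powr \<eta>) ^ Suc n" using T by (subst powr_realpow) auto
    finally have *: "T powr (\<eta> * real n + \<eta>) = (T powr \<eta>) ^ Suc n" .
    have "(C * Gamma \<eta>) ^ Suc n / Gamma (\<eta> * real n + \<eta>) * T powr (\<eta> * real n + \<eta>)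
        = q ^ Suc n / Gamma (\<eta> * real n + \<eta>)"
      unfolding * q_def power_mult_distrib by simp
    then have "(C * Gamma \<eta>) ^ Suc n / Gamma (\<eta> * real n + \<eta>) * T powr (\<eta> * real n + \<eta>) / (\<eta> * real n + \<eta>)
        = q ^ Suc n / Gamma (\<eta> * real n + \<eta>) / (\<eta> * real n + \<eta>)" by (simp only:)
    also have "\<dots> \<le> q ^ Suc n / Gamma (\<eta> * real n + \<eta>) / \<eta>"
      using D(1) q pos[of n] by (intro divide_left_mono) (auto simp: add_nonneg_pos)
    also have "\<dots> = b n" by (simp add: b_def)
    finally show ?thesis .
  qed
  ultimately show thesis using that weakly_singular_iter_kernel[OF G] by blast
qed

lemma volterra_cmult: "volterra G (\<lambda>s. c * f s) t = c * volterra G f t"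
  unfolding volterra_def set_lebesgue_integral_def
  by (simp add: mult.left_commute flip: integral_mult_right_zero mult_scaleR_right)

lemma volterra_diff:
  assumes "weakly_singular T \<eta> C G" "continuous_on {0..T} f" "continuous_on {0..T} g" "0 \<le> t" "t \<le> T"
  shows "volterra G (\<lambda>s. f s - g s) t = volterra G f t - volterra G g t"
  unfolding volterra_eq_cut[OF assms(4,5)] right_diff_distrib
  by (intro Bochner_Integration.integral_diff cut_mult_integrable[OF assms(1)] assms)

lemma volterra_add:
  assumes "weakly_singular T \<eta> C G" "continuous_on {0..T} f" "continuous_on {0..T} g" "0 \<le> t" "t \<le> T"
  shows "volterra G (\<lambda>s. f s + g s) t = volterra G f t + volterra G g t"
  unfolding volterra_eq_cut[OF assms(4,5)] distrib_left
  by (intro Bochner_Integration.integral_add cut_mult_integrable[OF assms(1)] assms)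

lemma volterra_iter_kernel_Suc:
  assumes "weakly_singular T \<eta> C G" "continuous_on {0..T} f" "0 \<le> t" "t \<le> T"
  shows "volterra (iter_kernel G (Suc n)) f t = volterra G (volterra (iter_kernel G n) f) t"
  using volterra_kernel_comp[OF assms(1) weakly_singular_iter_kernel[OF assms(1), of n] assms(2-)]
  by (simp add: kernel_comp_def[abs_def])

text \<open>
  A solution of \<open>h = - V\<^sub>G h\<close> is, up to sign, its own image under every iterate, and the
  norms of the iterates tend to zero.
\<close>

lemma volterra_homogeneous_unique:
  assumes G: "weakly_singular T \<eta> C G" and T: "T > 0" and h: "continuous_on {0..T} h"
    and eq: "\<And>t. t \<in> {0..T} \<Longrightarrow> h t + volterra G h t = 0" and t: "t \<in> {0..T}"
  shows "h t = 0"
proof -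
  obtain M where M: "M \<ge> 0" "\<forall>s\<in>{0..T}. norm (h s) \<le> M"
    using continuous_on_bounded_measurable(2)[OF h] by blast
  obtain b where b: "summable b" "\<And>n. b n \<ge> 0"
    and ws: "\<And>n. weakly_singular T (\<eta> * real n + \<eta>) ((C * Gamma \<eta>) ^ Suc n / Gamma (\<eta> * real n + \<eta>))
           (iter_kernel G n)"
    and bd: "\<And>n. (C * Gamma \<eta>) ^ Suc n / Gamma (\<eta> * real n + \<eta>) * T powr (\<eta> * real n + \<eta>) / (\<eta> * real n + \<eta>) \<le> b n"
    using iter_kernel_bounds[OF G T] by metis
  have it: "volterra (iter_kernel G n) h t = (-1) ^ Suc n * h t" if "t \<in> {0..T}" for n t
    using that
  proof (induction n arbitrary: t)
    case 0 then show ?case using eq[of t] by (simp add: eq_neg_iff_add_eq_0 add.commute)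
  next
    case (Suc n)
    have "volterra (iter_kernel G (Suc n)) h t = volterra G (\<lambda>s. (-1) ^ Suc n * h s) t"
      using Suc by (subst volterra_iter_kernel_Suc[OF G h]) (auto intro!: volterra_cong)
    also have "\<dots> = (-1) ^ Suc n * (- h t)"
      unfolding volterra_cmult eq_neg_iff_add_eq_0[THEN iffD2, OF eq[OF Suc.prems, unfolded add.commute[of "h t"]]] ..
    finally show ?case by simp
  qed
  have "norm (h t) \<le> M * b n" for n
  proof -
    have "norm (h t) = norm (volterra (iter_kernel G n) h t)"
      unfolding it[OF t] by (simp add: norm_mult norm_power)
    also have "\<dots> \<le> M * b n"
      using volterra_bound[OF ws h, of t M n] t M mult_left_mono[OF bd[of n], of M] by auto
    finally show ?thesis .
  qed
  moreover have "(\<lambda>n. M * b n) \<longlonglongrightarrow> M * 0"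
    by (intro tendsto_intros summable_LIMSEQ_zero b)
  ultimately have "norm (h t) \<le> M * 0"
    by (intro LIMSEQ_le_const) auto
  then show ?thesis by simp
qed

lemma volterra_sums:
  assumes G: "weakly_singular T \<eta> C G" and W: "\<And>n. continuous_on {0..T} (W n)"
    and b: "summable b" "\<And>n. b n \<ge> 0" and bd: "\<And>n s. s \<in> {0..T} \<Longrightarrow> norm (W n s) \<le> b n"
    and t: "0 \<le> t" "t \<le> T"
  shows "(\<lambda>n. volterra G (W n) t) sums volterra G (\<lambda>s. \<Sum>n. W n s) t"
proof -
  have sm: "summable (\<lambda>n. norm (W n s))" if "s \<in> {0..T}" for s
    by (rule summable_comparison_test'[OF b(1)]) (use bd[OF that] in auto)
  have "(\<lambda>n. LINT s|lborel. cut T G t s * W n s) sums (LINT s|lborel. (\<Sum>n. cut T G t s * W n s))"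
  proof (rule sums_integral)
    show "integrable lborel (\<lambda>s. cut T G t s * W n s)" for n
      by (rule cut_mult_integrable[OF G W])
    have "summable (\<lambda>n. norm (cut T G t s * W n s))" for s
      using summable_mult[OF sm, of s "norm (cut T G t s)"]
      by (cases "s \<in> {0..T}") (auto simp: norm_mult cut_def)
    then show "AE s in lborel. summable (\<lambda>n. norm (cut T G t s * W n s))" by simp
    show "summable (\<lambda>n. LINT s|lborel. norm (cut T G t s * W n s))"
      by (rule summable_comparison_test'[of "\<lambda>n. b n * (C * T powr \<eta> / \<eta>)" 0])
         (use b cut_mult_integrable(2)[OF G W t b(2)] bd in \<open>auto intro!: summable_mult2
            simp: integral_nonneg_AE abs_of_nonneg\<close>)
  qed
  moreover have "(\<Sum>n. cut T G t s * W n s) = cut T G t s * (\<Sum>n. W n s)" for s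
    by (cases "s \<in> {0..T}") (auto simp: cut_def intro!: suminf_mult summable_norm_cancel[OF sm])
  ultimately show ?thesis unfolding volterra_eq_cut[OF t] by simp
qed

text \<open>
  The series of iterated kernels converges absolutely at every point below the diagonal, being dominated
  by a Mittag-Leffler series in \<open>(t - s) powr \<eta>\<close>, and may be integrated term by term.
\<close>

lemma volterra_resolvent_sums:
  assumes G: "weakly_singular T \<eta> C G" and T: "T > 0" and f: "continuous_on {0..T} f"
    and t: "0 \<le> t" "t \<le> T"
  shows "(\<lambda>n. (-1) ^ n * volterra (iter_kernel G n) f t) sums volterra (resolvent_kernel G) f t"
proof -
  obtain M where M: "M \<ge> 0" "\<forall>s\<in>{0..T}. norm (f s) \<le> M"
    using continuous_on_bounded_measurable(2)[OF f] by blast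
  obtain b where b: "summable b" "\<And>n. b n \<ge> 0"
    and ws: "\<And>n. weakly_singular T (\<eta> * real n + \<eta>) ((C * Gamma \<eta>) ^ Suc n / Gamma (\<eta> * real n + \<eta>))
           (iter_kernel G n)"
    and bd: "\<And>n. (C * Gamma \<eta>) ^ Suc n / Gamma (\<eta> * real n + \<eta>) * T powr (\<eta> * real n + \<eta>) / (\<eta> * real n + \<eta>) \<le> b n"
    using iter_kernel_bounds[OF G T] by metis
  note D = weakly_singularD[OF G]
  have sm: "summable (\<lambda>n. norm (cut T (iter_kernel G n) t s))" for s
  proof (cases "0 \<le> s \<and> s < t")
    case True
    define x where "x = t - s"
    have x: "x > 0" using True by (simp add: x_def)
    define q where "q = C * Gamma \<eta> * x powr \<eta>"
    have q: "q \<ge> 0" using D Gamma_real_nonneg[of \<eta>] by (auto simp: q_def)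
    have "summable (\<lambda>n. q / x * (q ^ n / Gamma (\<eta> * real n + \<eta>)))"
      by (intro summable_mult summable_power_over_Gamma D q)
    then show ?thesis
    proof (rule summable_comparison_test'[of _ 0])
      fix n
      have "norm (iter_kernel G n t s) \<le> (C * Gamma \<eta>) ^ Suc n / Gamma (\<eta> * real n + \<eta>)
            * x powr (\<eta> * real n + \<eta> - 1)"
        using weakly_singularD(4)[OF ws, of s t n] True t by (simp add: x_def)
      also have "x powr (\<eta> * real n + \<eta> - 1) = (x powr \<eta>) ^ Suc n / x"
      proof -
        have "x powr (\<eta> * real n + \<eta> - 1) = x powr (\<eta> * real (Suc n)) / x"
          using x by (simp add: powr_diff algebra_simps)
        also have "x powr (\<eta> * real (Suc n)) = (x powr \<eta>) ^ Suc n"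
          using x by (simp only: powr_powr[symmetric] powr_realpow powr_gt_zero)
        finally show ?thesis .
      qed
      also have "(C * Gamma \<eta>) ^ Suc n / Gamma (\<eta> * real n + \<eta>) * ((x powr \<eta>) ^ Suc n / x)
          = q / x * (q ^ n / Gamma (\<eta> * real n + \<eta>))"
        unfolding q_def by (simp add: power_mult_distrib mult_ac)
      finally show "norm (norm (cut T (iter_kernel G n) t s)) \<le> q / x * (q ^ n / Gamma (\<eta> * real n + \<eta>))"
        using True t by (simp add: cut_def)
    qed
  qed (auto simp: cut_def)
  have "(\<lambda>n. LINT s|lborel. (-1) ^ n * (cut T (iter_kernel G n) t s * f s)) sums
        (LINT s|lborel. (\<Sum>n. (-1) ^ n * (cut T (iter_kernel G n) t s * f s)))"
  proof (rule sums_integral)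
    show "integrable lborel (\<lambda>s. (-1) ^ n * (cut T (iter_kernel G n) t s * f s))" for n
      by (intro integrable_mult_right cut_mult_integrable[OF ws f])
    show "AE s in lborel. summable (\<lambda>n. norm ((-1) ^ n * (cut T (iter_kernel G n) t s * f s)))"
      using summable_mult2[OF sm] by (auto simp: norm_mult norm_power)
    have le: "norm (LINT s|lborel. norm (cut T (iter_kernel G n) t s * f s)) \<le> M * b n" for n
      using cut_mult_integrable(2)[OF ws f t M(1), of n] M(2) mult_left_mono[OF bd[of n] M(1)]
      by (simp add: integral_nonneg_AE abs_of_nonneg)
    have "summable (\<lambda>n. LINT s|lborel. norm (cut T (iter_kernel G n) t s * f s))"
      by (rule summable_comparison_test'[OF summable_mult[OF b(1), of M], of 0]) (rule le)
    then show "summable (\<lambda>n. LINT s|lborel. norm ((-1) ^ n * (cut T (iter_kernel G n) t s * f s)))"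
      by (simp add: norm_mult norm_power)
  qed
  moreover have "(\<Sum>n. (-1) ^ n * (cut T (iter_kernel G n) t s * f s))
      = cut T (resolvent_kernel G) t s * f s" for s
  proof -
    have "summable (\<lambda>n. (-1) ^ n * cut T (iter_kernel G n) t s)"
      by (rule summable_norm_cancel) (use sm[of s] in \<open>simp add: norm_mult norm_power\<close>)
    from suminf_mult2[OF this, of "f s"]
    have "(\<Sum>n. (-1) ^ n * (cut T (iter_kernel G n) t s * f s))
       = (\<Sum>n. (-1) ^ n * cut T (iter_kernel G n) t s) * f s" by (simp add: mult.assoc)
    also have "(\<Sum>n. (-1) ^ n * cut T (iter_kernel G n) t s) = cut T (resolvent_kernel G) t s"
      by (cases "0 \<le> s \<and> s < t \<and> t \<le> T") (auto simp: cut_def resolvent_kernel_def)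
    finally show ?thesis .
  qed
  ultimately show ?thesis unfolding volterra_eq_cut[OF t] by simp
qed

text \<open>
  The Neumann series: applying \<open>V\<^sub>G\<close> to \<open>S = V\<^sub>G f - V\<^sub>G\<^sup>2 f + \<dots>\<close> shifts it by one term,
  so that \<open>V\<^sub>G S = V\<^sub>G f - S\<close>, which is the equation for \<open>f - S\<close>.
\<close>

theorem resolvent_solves_volterra:
  assumes G: "weakly_singular T \<eta> C G" and T: "T > 0"
    and pres: "\<And>f. continuous_on {0..T} f \<Longrightarrow> continuous_on {0..T} (volterra G f)"
    and f: "continuous_on {0..T} f"
  defines "v \<equiv> \<lambda>t. f t - volterra (resolvent_kernel G) f t"
  shows "continuous_on {0..T} v" "\<And>t. t \<in> {0..T} \<Longrightarrow> v t + volterra G v t = f t"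
proof -
  obtain M where M: "M \<ge> 0" "\<forall>s\<in>{0..T}. norm (f s) \<le> M"
    using continuous_on_bounded_measurable(2)[OF f] by blast
  obtain b where b: "summable b" "\<And>n. b n \<ge> 0"
    and ws: "\<And>n. weakly_singular T (\<eta> * real n + \<eta>) ((C * Gamma \<eta>) ^ Suc n / Gamma (\<eta> * real n + \<eta>))
           (iter_kernel G n)"
    and bd: "\<And>n. (C * Gamma \<eta>) ^ Suc n / Gamma (\<eta> * real n + \<eta>) * T powr (\<eta> * real n + \<eta>) / (\<eta> * real n + \<eta>) \<le> b n"
    using iter_kernel_bounds[OF G T] by metis
  define W where "W = (\<lambda>n t. (-1) ^ n * volterra (iter_kernel G n) f t)"
  let ?S = "volterra (resolvent_kernel G) f"
  have sums: "(\<lambda>n. W n t) sums ?S t" if "t \<in> {0..T}" for t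
    unfolding W_def using volterra_resolvent_sums[OF G T f] that by auto
  have Wb: "norm (W n t) \<le> M * b n" if "t \<in> {0..T}" for n t
    using volterra_bound[OF ws f, of t M n] that M mult_left_mono[OF bd[of n], of M]
    by (auto simp: W_def norm_mult norm_power)
  have "continuous_on {0..T} (volterra (iter_kernel G n) f)" for n
  proof (induction n)
    case (Suc n)
    show ?case
      using pres[OF Suc] volterra_iter_kernel_Suc[OF G f, of _ n]
      by (metis (no_types, lifting) atLeastAtMost_iff continuous_on_cong)
  qed (use pres f in simp)
  then have Wc: "continuous_on {0..T} (W n)" for n
    unfolding W_def by (intro continuous_intros)
  have WS: "volterra G (W n) t = - W (Suc n) t" if "t \<in> {0..T}" for n t
    using volterra_iter_kernel_Suc[OF G f, of t n] that unfolding W_def volterra_cmult by simp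
  have suminf: "(\<Sum>n. W n t) = ?S t" if "t \<in> {0..T}" for t
    using sums_unique[OF sums[OF that]] by simp
  have "uniform_limit {0..T} (\<lambda>n t. \<Sum>i<n. W i t) (\<lambda>t. \<Sum>i. W i t) sequentially"
    by (rule Weierstrass_m_test[where M="\<lambda>n. M * b n"]) (use Wb b in \<open>auto intro: summable_mult\<close>)
  then have "continuous_on {0..T} (\<lambda>t. \<Sum>i. W i t)"
    by (rule uniform_limit_theorem[rotated]) (auto intro!: always_eventually continuous_intros Wc)
  then have Sc: "continuous_on {0..T} ?S"
    by (rule continuous_on_cong[THEN iffD1, OF refl suminf, rotated])
  then show "continuous_on {0..T} v" unfolding v_def using f by (intro continuous_intros)
  fix t assume t: "t \<in> {0..T}"
  have "(\<lambda>n. volterra G (W n) t) sums volterra G (\<lambda>s. \<Sum>n. W n s) t"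
    by (rule volterra_sums[OF G Wc, where b="\<lambda>n. M * b n"])
       (use Wb b M t in \<open>auto intro: summable_mult\<close>)
  then have "(\<lambda>n. - W (Suc n) t) sums volterra G ?S t"
    using volterra_cong[of t G G "\<lambda>s. \<Sum>n. W n s" ?S] suminf t WS[OF t] by auto
  moreover have "(\<lambda>n. - W (Suc n) t) sums (- (?S t - W 0 t))"
  proof (rule sums_minus)
    show "(\<lambda>n. W (Suc n) t) sums (?S t - W 0 t)"
      using sums[OF t] by (subst sums_Suc_iff) simp
  qed
  ultimately have "volterra G ?S t = W 0 t - ?S t" by (auto dest: sums_unique2)
  moreover have "volterra G v t = volterra G f t - volterra G ?S t"
    unfolding v_def using volterra_diff[OF G f Sc] t by auto
  ultimately show "v t + volterra G v t = f t" by (simp add: v_def W_def)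
qed

section \<open>Mittag-Leffler kernels\<close>

lemma weakly_singular_continuousI:
  assumes "\<eta> > 0" "C \<ge> 0"
    and cont: "continuous_on {(t, s). 0 \<le> s \<and> s < t \<and> t \<le> T} (\<lambda>(t, s). G t s)"
    and bound: "\<And>t s. 0 \<le> s \<Longrightarrow> s < t \<Longrightarrow> t \<le> T \<Longrightarrow> norm (G t s) \<le> C * (t - s) powr (\<eta> - 1)"
  shows "weakly_singular T \<eta> C G"
proof -
  let ?S = "{(t, s). 0 \<le> s \<and> s < t \<and> t \<le> (T::real)}"
  have "{p \<in> space (borel \<Otimes>\<^sub>M borel). 0 \<le> snd p \<and> snd p < fst p \<and> fst p \<le> T}
      \<in> sets (borel \<Otimes>\<^sub>M (borel :: real measure))"
    by measurable
  moreover have "?S = {p \<in> space (borel \<Otimes>\<^sub>M borel). 0 \<le> snd p \<and> snd p < fst p \<and> fst p \<le> T}"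
    by (auto simp: space_pair_measure)
  ultimately have S: "?S \<in> sets borel" unfolding borel_prod by (simp only:)
  have "(\<lambda>p. indicator ?S p *\<^sub>R (\<lambda>(t, s). G t s) p) \<in> borel_measurable borel"
    by (rule borel_measurable_continuous_on_indicator[OF S cont])
  also have "(\<lambda>p. indicator ?S p *\<^sub>R (\<lambda>(t, s). G t s) p) = case_prod (cut T G)"
    by (auto simp: fun_eq_iff cut_def indicator_def)
  finally show ?thesis
    using assms unfolding weakly_singular_def by (simp add: borel_prod)
qed

text \<open>
  In the variable \<open>x = t - s\<close> the singularity sits at \<open>x = 0\<close> for every \<open>t\<close>, so that one integrable
  power dominates all integrands and dominated convergence applies.
\<close>

lemma volterra_continuous:
  assumes G: "weakly_singular T \<eta> C G" and T: "T > 0"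
    and cont: "continuous_on {(t, s). 0 \<le> s \<and> s < t \<and> t \<le> T} (\<lambda>(t, s). G t s)"
    and f: "continuous_on {0..T} f"
  shows "continuous_on {0..T} (volterra G f)"
proof -
  note D = weakly_singularD[OF G]
  obtain M where M: "M \<ge> 0" "\<forall>s\<in>{0..T}. norm (f s) \<le> M"
    using continuous_on_bounded_measurable(2)[OF f] by blast
  define F where "F = (\<lambda>t x. cut T G t (t - x) * f (t - x))"
  have V: "volterra G f t = (LINT x|lborel. F t x)" if "t \<in> {0..T}" for t
    using that lborel_integral_real_affine[of "-1" "\<lambda>s. cut T G t s * f s" t]
    by (simp add: volterra_eq_cut[of t T] F_def)
  have Fm: "F t \<in> borel_measurable lborel" for t
  proof -
    note [measurable] = D(5)[of t] continuous_on_bounded_measurable(1)[OF f]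
    have "(\<lambda>x. cut T G t (t - x) * (\<lambda>s. indicator {0..T} s *\<^sub>R f s) (t - x)) \<in> borel_measurable lborel"
      by measurable
    then show ?thesis unfolding F_def cut_mult_extension[of T G _ _ f] .
  qed
  let ?w = "\<lambda>x. M * C * (indicator {0<..T} x * x powr (\<eta> - 1))"
  have w: "integrable lborel ?w"
  proof -
    have "integrable lborel (\<lambda>x. indicator {0<..<T} x * ((T - x) powr (1 - 1) * (x - 0) powr (\<eta> - 1)))"
      using has_bochner_integral_Beta_interval[of 1 \<eta> 0 T] D(1) T
      by (simp add: has_bochner_integral_iff)
    then have "integrable lborel (\<lambda>x. indicator {0<..T} x * x powr (\<eta> - 1))"
      by (subst lborel_finite_difference(2)[of "{T}"]; assumption?)
         (auto simp: indicator_def)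
    then show ?thesis by simp
  qed
  have Fb: "norm (F t x) \<le> ?w x" for t x
  proof (cases "0 \<le> t - x \<and> t - x < t \<and> t \<le> T")
    case True
    then have "norm (G t (t - x)) * norm (f (t - x)) \<le> (C * x powr (\<eta> - 1)) * M"
      using D(4)[of "t - x" t] D(2) M by (intro mult_mono) auto
    with True show ?thesis by (auto simp: F_def cut_def norm_mult mult_ac)
  qed (use M D(2) in \<open>auto simp: F_def cut_def\<close>)
  show ?thesis
    unfolding continuous_on_sequentially
  proof (intro allI ballI impI, elim conjE)
    fix u :: "nat \<Rightarrow> real" and t
    assume t: "t \<in> {0..T}" and u: "\<forall>n. u n \<in> {0..T}" and lim: "u \<longlonglongrightarrow> t"
    \<comment> \<open>At \<open>x = t\<close> the extended kernel jumps from its value at \<open>s = 0\<close> to zero.\<close>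
    have ptw: "(\<lambda>n. F (u n) x) \<longlonglongrightarrow> F t x" if xt: "x \<noteq> t" for x
    proof -
      consider "x \<le> 0" | "x > t" | "0 < x" "x < t" using xt by linarith
      then show ?thesis
      proof cases
        case 1
        then show ?thesis by (simp add: F_def cut_def)
      next
        case 2
        then have "eventually (\<lambda>n. u n < x) sequentially"
          using lim order_tendstoD(2) by blast
        then have "eventually (\<lambda>n. F t x = F (u n) x) sequentially"
          by eventually_elim (use 2 in \<open>auto simp: F_def cut_def\<close>)
        then show ?thesis by (rule tendsto_eventually[OF eventually_mono]) auto
      next
        case 3
        then have ev: "eventually (\<lambda>n. x < u n) sequentially"
          using lim order_tendstoD(1) by blast
        let ?S = "{(t, s). 0 \<le> s \<and> s < t \<and> t \<le> (T::real)}"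
        have "(\<lambda>n. (\<lambda>(t, s). G t s) (u n, u n - x)) \<longlonglongrightarrow> (\<lambda>(t, s). G t s) (t, t - x)"
        proof (rule continuous_on_tendsto_compose[OF cont])
          show "(\<lambda>n. (u n, u n - x)) \<longlonglongrightarrow> (t, t - x)" by (intro tendsto_intros lim)
          show "(t, t - x) \<in> ?S" using 3 t by auto
          show "\<forall>\<^sub>F n in sequentially. (u n, u n - x) \<in> ?S"
            using ev by eventually_elim (use 3 u in auto)
        qed
        moreover have "(\<lambda>n. f (u n - x)) \<longlonglongrightarrow> f (t - x)"
        proof (rule continuous_on_tendsto_compose[OF f])
          show "(\<lambda>n. u n - x) \<longlonglongrightarrow> t - x" by (intro tendsto_intros lim)
          show "\<forall>\<^sub>F n in sequentially. u n - x \<in> {0..T}"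
            using ev
          proof eventually_elim
            case (elim n)
            then show ?case using u[rule_format, of n] 3 by auto
          qed
        qed (use 3 t in auto)
        ultimately have L: "(\<lambda>n. G (u n) (u n - x) * f (u n - x)) \<longlonglongrightarrow> G t (t - x) * f (t - x)"
          by (auto intro: tendsto_mult)
        have E: "eventually (\<lambda>n. G (u n) (u n - x) * f (u n - x) = F (u n) x) sequentially"
          using ev by eventually_elim (use 3 u in \<open>auto simp: F_def cut_def\<close>)
        have "G t (t - x) * f (t - x) = F t x" using 3 t by (auto simp: F_def cut_def)
        with Lim_transform_eventually[OF L E] show ?thesis by simp
      qed
    qed
    have "(\<lambda>n. LINT x|lborel. F (u n) x) \<longlonglongrightarrow> (LINT x|lborel. F t x)"
    proof (rule integral_dominated_convergence[where w="?w"])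
      have "AE x in lborel. x \<noteq> t" by (rule AE_lborel_singleton)
      then show "AE x in lborel. (\<lambda>n. F (u n) x) \<longlonglongrightarrow> F t x"
        by eventually_elim (rule ptw)
    qed (use Fm w Fb in auto)
    then show "(volterra G f \<circ> u) \<longlonglongrightarrow> volterra G f t"
      using V u t by (simp add: o_def)
  qed
qed

text \<open>
  The coefficients \<open>(\<gamma>)\<^sub>n \<omega>\<^sup>n / n!\<close> are replaced by an arbitrary sequence of at most geometric growth. This
  generality is needed: the proof of injectivity removes the first term of the series, and the rest is no
  longer a three-parameter Mittag-Leffler function in general.
\<close>

definition geometrically_bounded :: "(nat \<Rightarrow> complex) \<Rightarrow> bool" where
  "geometrically_bounded c \<longleftrightarrow> (\<exists>A\<ge>0. \<exists>B\<ge>0. \<forall>n. norm (c n) \<le> A * B ^ n)"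

definition ml_series :: "(nat \<Rightarrow> complex) \<Rightarrow> real \<Rightarrow> real \<Rightarrow> complex \<Rightarrow> complex" where
  "ml_series c \<rho> a z = (\<Sum>n. c n / of_real (Gamma (\<rho> * real n + a)) * z ^ n)"

text \<open>
  For \<open>s < t\<close> this is the series of \<open>c n * (t - s) powr (\<rho> n + a - 1) / Gamma (\<rho> n + a)\<close>. The singular
  factor is kept outside the series, which leaves an entire function.
\<close>

definition ml_kernel :: "(nat \<Rightarrow> complex) \<Rightarrow> real \<Rightarrow> real \<Rightarrow> real \<Rightarrow> real \<Rightarrow> complex" where
  "ml_kernel c \<rho> a t s = of_real ((t - s) powr (a - 1)) * ml_series c \<rho> a (of_real ((t - s) powr \<rho>))"

lemma geometrically_bounded_shift:
  assumes "geometrically_bounded c"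
  shows "geometrically_bounded (\<lambda>n. c (Suc n))"
proof -
  obtain A B where "A \<ge> 0" "B \<ge> 0" "\<forall>n. norm (c n) \<le> A * B ^ n"
    using assms by (auto simp: geometrically_bounded_def)
  then show ?thesis
    unfolding geometrically_bounded_def
    by (intro exI[of _ "A * B"] conjI exI[of _ B] allI) (auto simp: mult.assoc simp flip: power_Suc)
qed

lemma Gamma_arg_pos: "\<rho> > 0 \<Longrightarrow> a > 0 \<Longrightarrow> Gamma (\<rho> * real n + a) > (0::real)"
  by (intro Gamma_real_pos add_nonneg_pos) auto

lemma ml_summable:
  assumes "geometrically_bounded c" "\<rho> > 0" "a > 0" "r \<ge> 0"
  shows "summable (\<lambda>n. norm (c n) / Gamma (\<rho> * real n + a) * r ^ n)"
proof -
  obtain A B where AB: "A \<ge> 0" "B \<ge> 0" "\<And>n. norm (c n) \<le> A * B ^ n"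
    using assms by (auto simp: geometrically_bounded_def)
  have "summable (\<lambda>n. A * ((B * r) ^ n / Gamma (\<rho> * real n + a)))"
    using assms AB by (intro summable_mult summable_power_over_Gamma) auto
  then show ?thesis
  proof (rule summable_comparison_test'[of _ 0])
    fix n
    have g: "Gamma (\<rho> * real n + a) > 0" using assms by (intro Gamma_arg_pos)
    have "norm (c n) / Gamma (\<rho> * real n + a) * r ^ n \<le> A * B ^ n / Gamma (\<rho> * real n + a) * r ^ n"
      using g AB assms by (intro mult_right_mono divide_right_mono) auto
    then show "norm (norm (c n) / Gamma (\<rho> * real n + a) * r ^ n)
        \<le> A * ((B * r) ^ n / Gamma (\<rho> * real n + a))"
      using g assms(4) by (simp add: power_mult_distrib abs_mult)
  qed
qed

lemma ml_series_summable:
  assumes "geometrically_bounded c" "\<rho> > 0" "a > 0"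
  shows "summable (\<lambda>n. norm (c n / of_real (Gamma (\<rho> * real n + a)) * z ^ n))"
  using ml_summable[OF assms, of "norm z"] Gamma_arg_pos[OF assms(2,3)]
  by (simp add: norm_mult norm_divide norm_power abs_of_pos)

lemma ml_kernel_sums:
  assumes "geometrically_bounded c" "\<rho> > 0" "a > 0" "s < t"
  shows "(\<lambda>n. c n * of_real ((t - s) powr (\<rho> * real n + a - 1) / Gamma (\<rho> * real n + a)))
           sums ml_kernel c \<rho> a t s"
    and "summable (\<lambda>n. norm (c n * of_real ((t - s) powr (\<rho> * real n + a - 1) / Gamma (\<rho> * real n + a))))"
proof -
  have e: "of_real ((t - s) powr (a - 1)) * (c n / of_real (Gamma (\<rho> * real n + a)) * of_real ((t - s) powr \<rho>) ^ n)
     = c n * complex_of_real ((t - s) powr (\<rho> * real n + a - 1) / Gamma (\<rho> * real n + a))" for n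
  proof -
    have "(t - s) powr (\<rho> * real n + a - 1) = (t - s) powr (a - 1) * ((t - s) powr \<rho>) powr real n"
    proof -
      have "\<rho> * real n + a - 1 = (a - 1) + \<rho> * real n" by simp
      then show ?thesis by (simp only: powr_add powr_powr)
    qed
    also have "((t - s) powr \<rho>) powr real n = ((t - s) powr \<rho>) ^ n"
      using assms by (intro powr_realpow) auto
    finally show ?thesis by simp
  qed
  have S: "summable (\<lambda>n. norm (c n / of_real (Gamma (\<rho> * real n + a)) * complex_of_real ((t - s) powr \<rho>) ^ n))"
    by (rule ml_series_summable[OF assms(1-3)])
  show "(\<lambda>n. c n * of_real ((t - s) powr (\<rho> * real n + a - 1) / Gamma (\<rho> * real n + a)))
           sums ml_kernel c \<rho> a t s"
    unfolding ml_kernel_def ml_series_def e[symmetric]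
    by (intro sums_mult summable_sums summable_norm_cancel[OF S])
  show "summable (\<lambda>n. norm (c n * of_real ((t - s) powr (\<rho> * real n + a - 1) / Gamma (\<rho> * real n + a))))"
    unfolding e[symmetric] using summable_mult[OF S, of "norm (complex_of_real ((t - s) powr (a - 1)))"]
    by (simp only: norm_mult[of "complex_of_real ((t - s) powr (a - 1))"])
qed

lemma isCont_ml_series:
  assumes "geometrically_bounded c" "\<rho> > 0" "a > 0"
  shows "isCont (ml_series c \<rho> a) z"
  unfolding ml_series_def[abs_def]
  by (rule isCont_powser_converges_everywhere) (rule summable_norm_cancel[OF ml_series_summable[OF assms]])

lemma ml_kernel_continuous:
  assumes "geometrically_bounded c" "\<rho> > 0" "a > 0"
  shows "continuous_on {(t, s). 0 \<le> s \<and> s < t \<and> t \<le> T} (\<lambda>(t, s). ml_kernel c \<rho> a t s)"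
proof -
  have ser: "continuous_on UNIV (ml_series c \<rho> a)"
    using isCont_ml_series[OF assms] by (simp add: continuous_on_eq_continuous_at)
  let ?S = "{(t, s). 0 \<le> s \<and> s < t \<and> t \<le> T}"
  have pw: "continuous_on ?S (\<lambda>p. complex_of_real ((fst p - snd p) powr b))" for b
    by (intro continuous_on_of_real continuous_on_powr continuous_on_diff continuous_on_fst
        continuous_on_snd continuous_on_id continuous_on_const) auto
  show ?thesis
    unfolding ml_kernel_def case_prod_unfold
    using continuous_on_mult[OF pw continuous_on_compose2[OF ser pw[of \<rho>]], of "a - 1"]
    by (simp add: case_prod_unfold)
qed

lemma weakly_singular_ml_kernel:
  assumes "geometrically_bounded c" "\<rho> > 0" "a > 0" "T > 0"
  shows "\<exists>C. weakly_singular T a C (ml_kernel c \<rho> a)"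
proof -
  define C where "C = (\<Sum>n. norm (c n) / Gamma (\<rho> * real n + a) * (T powr \<rho>) ^ n)"
  note g = Gamma_arg_pos[OF assms(2,3)]
  have sC: "summable (\<lambda>n. norm (c n) / Gamma (\<rho> * real n + a) * (T powr \<rho>) ^ n)"
    by (rule ml_summable[OF assms(1-3)]) simp
  have "weakly_singular T a C (ml_kernel c \<rho> a)"
  proof (rule weakly_singular_continuousI[OF assms(3) _ ml_kernel_continuous[OF assms(1-3)]])
    show "C \<ge> 0" unfolding C_def by (intro suminf_nonneg sC) (use g in \<open>simp add: less_imp_le\<close>)
    fix t s :: real assume ts: "0 \<le> s" "s < t" "t \<le> T"
    let ?z = "complex_of_real ((t - s) powr \<rho>)"
    note S = ml_series_summable[OF assms(1-3), of ?z]
    have "norm (ml_series c \<rho> a ?z) \<le> (\<Sum>n. norm (c n / of_real (Gamma (\<rho> * real n + a)) * ?z ^ n))"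
      unfolding ml_series_def by (rule summable_norm[OF S])
    also have "\<dots> \<le> C"
      unfolding C_def
    proof (rule suminf_le[OF _ S sC])
      fix n
      have "((t - s) powr \<rho>) ^ n \<le> (T powr \<rho>) ^ n"
        using ts assms by (intro power_mono powr_mono2) auto
      then show "norm (c n / of_real (Gamma (\<rho> * real n + a)) * ?z ^ n)
            \<le> norm (c n) / Gamma (\<rho> * real n + a) * (T powr \<rho>) ^ n"
        using g[of n] by (simp add: norm_mult norm_divide norm_power abs_of_pos divide_right_mono mult_left_mono)
    qed
    finally have le: "norm (ml_series c \<rho> a ?z) \<le> C" .
    show "norm (ml_kernel c \<rho> a t s) \<le> C * (t - s) powr (a - 1)"
      using mult_right_mono[OF le, of "(t - s) powr (a - 1)"]
      by (simp add: ml_kernel_def norm_mult mult.commute)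
  qed
  then show ?thesis ..
qed

lemma volterra_ml_continuous:
  assumes "geometrically_bounded c" "\<rho> > 0" "a > 0" "T > 0" "continuous_on {0..T} f"
  shows "continuous_on {0..T} (volterra (ml_kernel c \<rho> a) f)"
  using weakly_singular_ml_kernel[OF assms(1-4)] volterra_continuous ml_kernel_continuous[OF assms(1-3)]
    assms(4,5) by blast

text \<open>The kernel of the Riemann-Liouville fractional integral of order \<open>\<alpha>\<close>.\<close>

definition rl_kernel :: "real \<Rightarrow> real \<Rightarrow> real \<Rightarrow> complex" where
  "rl_kernel \<alpha> t s = of_real ((t - s) powr (\<alpha> - 1) / Gamma \<alpha>)"

lemma weakly_singular_rl_kernel:
  assumes "\<alpha> > 0"
  shows "weakly_singular T \<alpha> (1 / Gamma \<alpha>) (rl_kernel \<alpha>)"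
proof (rule weakly_singular_continuousI)
  have g: "Gamma \<alpha> > 0" using assms by (rule Gamma_real_pos)
  show "continuous_on {(t, s). 0 \<le> s \<and> s < t \<and> t \<le> T} (\<lambda>(t, s). rl_kernel \<alpha> t s)"
    unfolding rl_kernel_def case_prod_unfold using g by (intro continuous_intros) auto
  show "norm (rl_kernel \<alpha> t s) \<le> 1 / Gamma \<alpha> * (t - s) powr (\<alpha> - 1)" for t s
    using g by (simp add: rl_kernel_def norm_divide abs_of_pos)
qed (use assms Gamma_real_pos[of \<alpha>] in auto)

text \<open>
  Term by term this is the Beta integral: the Gamma factors in the denominators are exactly those that make
  Riemann-Liouville kernels a convolution semigroup.
\<close>

lemma rl_comp_ml_kernel:
  assumes c: "geometrically_bounded c" and pos: "\<rho> > 0" "a > 0" "\<alpha> > 0" and st: "s < t"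
  shows "kernel_comp (rl_kernel \<alpha>) (ml_kernel c \<rho> a) t s = ml_kernel c \<rho> (\<alpha> + a) t s"
proof -
  have g: "Gamma \<alpha> > 0" using pos by (intro Gamma_real_pos)
  note gn = Gamma_arg_pos[OF pos(1,2)]
  define h where "h = (\<lambda>n \<xi>. indicator {s<..<t} \<xi> * ((t - \<xi>) powr (\<alpha> - 1) * (\<xi> - s) powr (\<rho> * real n + a - 1)))"
  define k where "k = (\<lambda>n. 1 / (Gamma \<alpha> * Gamma (\<rho> * real n + a)))"
  let ?f = "\<lambda>n \<xi>. c n * of_real (k n * h n \<xi>)"
  have h0: "h n \<xi> \<ge> 0" and k0: "k n \<ge> 0" for n \<xi>
    using g gn[of n] by (auto simp: h_def k_def)
  have hb: "has_bochner_integral lborel (\<lambda>\<xi>. k n * h n \<xi>)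
      ((t - s) powr (\<rho> * real n + (\<alpha> + a) - 1) / Gamma (\<rho> * real n + (\<alpha> + a)))" for n
  proof -
    have "has_bochner_integral lborel (\<lambda>\<xi>. k n * h n \<xi>)
       (k n * (Beta \<alpha> (\<rho> * real n + a) * (t - s) powr (\<alpha> + (\<rho> * real n + a) - 1)))"
      unfolding h_def using pos st
      by (intro has_bochner_integral_mult_right has_bochner_integral_Beta_interval add_nonneg_pos) auto
    moreover have e: "\<alpha> + (\<rho> * real n + a) = \<rho> * real n + (\<alpha> + a)" by simp
    have "k n * Beta \<alpha> (\<rho> * real n + a) = 1 / Gamma (\<rho> * real n + (\<alpha> + a))"
      using g gn[of n] unfolding k_def Beta_def e by simp
    then have "k n * (Beta \<alpha> (\<rho> * real n + a) * (t - s) powr (\<alpha> + (\<rho> * real n + a) - 1))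
        = (t - s) powr (\<rho> * real n + (\<alpha> + a) - 1) / Gamma (\<rho> * real n + (\<alpha> + a))"
      unfolding e mult.assoc[symmetric] by simp
    ultimately show ?thesis by (simp only:)
  qed
  note int = has_bochner_integral_integral_eq[OF hb]
  have fi: "integrable lborel (?f n)" for n
  proof (rule integrable_mult_right)
    have "integrable lborel (\<lambda>\<xi>. k n * h n \<xi>)" using hb[of n] by (rule integrable.intros)
    then show "integrable lborel (\<lambda>\<xi>. complex_of_real (k n * h n \<xi>))" by (rule integrable_of_real)
  qed
  have fint: "(LINT \<xi>|lborel. ?f n \<xi>)
     = c n * of_real ((t - s) powr (\<rho> * real n + (\<alpha> + a) - 1) / Gamma (\<rho> * real n + (\<alpha> + a)))" for n
    using int[of n] by (simp del: of_real_mult of_real_divide)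
  have nint: "(LINT \<xi>|lborel. norm (?f n \<xi>))
     = norm (c n * of_real ((t - s) powr (\<rho> * real n + (\<alpha> + a) - 1) / Gamma (\<rho> * real n + (\<alpha> + a))))" for n
  proof -
    have "norm (?f n \<xi>) = norm (c n) * (k n * h n \<xi>)" for \<xi>
      using h0 k0 by (simp add: norm_mult abs_of_nonneg)
    then have "(LINT \<xi>|lborel. norm (?f n \<xi>)) = norm (c n) * (LINT \<xi>|lborel. k n * h n \<xi>)" by simp
    also have "\<dots> = norm (c n * of_real ((t - s) powr (\<rho> * real n + (\<alpha> + a) - 1) / Gamma (\<rho> * real n + (\<alpha> + a))))"
      unfolding int using Gamma_arg_pos[of \<rho> "\<alpha> + a" n] pos
      by (simp add: norm_mult norm_divide abs_of_pos)
    finally show ?thesis .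
  qed
  note sm = ml_kernel_sums[OF c pos(1), of "\<alpha> + a" s t]
  have fs: "(\<lambda>n. ?f n \<xi>) sums (indicator {s<..<t} \<xi> *\<^sub>R (rl_kernel \<alpha> t \<xi> * ml_kernel c \<rho> a \<xi> s))"
    and fsn: "summable (\<lambda>n. norm (?f n \<xi>))" for \<xi>
  proof -
    have "(\<lambda>n. ?f n \<xi>) sums (indicator {s<..<t} \<xi> *\<^sub>R (rl_kernel \<alpha> t \<xi> * ml_kernel c \<rho> a \<xi> s))
       \<and> summable (\<lambda>n. norm (?f n \<xi>))"
    proof (cases "s < \<xi> \<and> \<xi> < t")
      case True
      have e: "?f n \<xi> = rl_kernel \<alpha> t \<xi> *
          (c n * of_real ((\<xi> - s) powr (\<rho> * real n + a - 1) / Gamma (\<rho> * real n + a)))" for n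
        using True by (simp add: h_def k_def rl_kernel_def)
      have sx: "s < \<xi>" using True by simp
      show ?thesis
        unfolding e norm_mult[of "rl_kernel \<alpha> t \<xi>"]
        using True sums_mult[OF ml_kernel_sums(1)[OF c pos(1,2) sx], of "rl_kernel \<alpha> t \<xi>"]
          summable_mult[OF ml_kernel_sums(2)[OF c pos(1,2) sx], of "norm (rl_kernel \<alpha> t \<xi>)"]
        by simp
    qed (simp add: h_def)
    then show "(\<lambda>n. ?f n \<xi>) sums (indicator {s<..<t} \<xi> *\<^sub>R (rl_kernel \<alpha> t \<xi> * ml_kernel c \<rho> a \<xi> s))"
      "summable (\<lambda>n. norm (?f n \<xi>))" by auto
  qed
  have "(\<lambda>n. LINT \<xi>|lborel. ?f n \<xi>) sums (LINT \<xi>|lborel. (\<Sum>n. ?f n \<xi>))"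
  proof (rule sums_integral[OF fi])
    show "AE \<xi> in lborel. summable (\<lambda>n. norm (?f n \<xi>))" using fsn by (intro AE_I2)
    show "summable (\<lambda>n. LINT \<xi>|lborel. norm (?f n \<xi>))"
      unfolding nint using sm(2) pos st by simp
  qed
  moreover have "(\<lambda>n. LINT \<xi>|lborel. ?f n \<xi>) sums ml_kernel c \<rho> (\<alpha> + a) t s"
    unfolding fint using sm(1) pos st by simp
  ultimately have "(LINT \<xi>|lborel. (\<Sum>n. ?f n \<xi>)) = ml_kernel c \<rho> (\<alpha> + a) t s"
    by (rule sums_unique2)
  moreover have "(\<Sum>n. ?f n \<xi>) = indicator {s<..<t} \<xi> *\<^sub>R (rl_kernel \<alpha> t \<xi> * ml_kernel c \<rho> a \<xi> s)" for \<xi>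
    using fs[of \<xi>] by (rule sums_unique[symmetric])
  moreover have "kernel_comp (rl_kernel \<alpha>) (ml_kernel c \<rho> a) t s
     = (LINT \<xi>|lborel. indicator {s<..<t} \<xi> *\<^sub>R (rl_kernel \<alpha> t \<xi> * ml_kernel c \<rho> a \<xi> s))"
    unfolding kernel_comp_def set_lebesgue_integral_def
    by (rule lborel_finite_difference[of "{s,t}"]) (auto simp: indicator_def)
  ultimately show ?thesis by simp
qed

lemma volterra_rl_ml_kernel:
  assumes c: "geometrically_bounded c" and pos: "\<rho> > 0" "a > 0" "\<alpha> > 0" "T > 0"
    and f: "continuous_on {0..T} f" and t: "0 \<le> t" "t \<le> T"
  shows "volterra (rl_kernel \<alpha>) (volterra (ml_kernel c \<rho> a) f) t = volterra (ml_kernel c \<rho> (\<alpha> + a)) f t"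
proof -
  obtain C where "weakly_singular T a C (ml_kernel c \<rho> a)"
    using weakly_singular_ml_kernel[OF c pos(1,2,4)] by blast
  from volterra_kernel_comp[OF weakly_singular_rl_kernel[OF pos(3)] this f t]
  show ?thesis
    using volterra_cong[of t "kernel_comp (rl_kernel \<alpha>) (ml_kernel c \<rho> a)" "ml_kernel c \<rho> (\<alpha> + a)" f f]
      rl_comp_ml_kernel[OF c pos(1,2,3)] by simp
qed

lemma volterra_rl_one_derivative:
  assumes g: "continuous_on {0..T} g" and t: "t \<in> {0..T}"
  shows "(volterra (rl_kernel 1) g has_vector_derivative g t) (at t within {0..T})"
proof -
  have e: "volterra (rl_kernel 1) g u = integral {0..u} g" if u: "u \<in> {0..T}" for u
  proof -
    have "continuous_on {0..u} g" using g u by (auto intro: continuous_on_subset)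
    then have si: "set_integrable lborel {0..u} g" by (rule borel_integrable_atLeastAtMost')
    have "volterra (rl_kernel 1) g u = volterra (\<lambda>_ _. 1) g u"
      by (rule volterra_cong) (auto simp: rl_kernel_def)
    also have "\<dots> = (LINT s:{0..u}|lborel. g s)" by (simp add: volterra_def)
    also have "\<dots> = integral {0..u} g" by (rule set_borel_integral_eq_integral(2)[OF si])
    finally show ?thesis .
  qed
  have "((\<lambda>u. integral {0..u} g) has_vector_derivative g t) (at t within {0..T})"
    by (rule integral_has_vector_derivative[OF g t])
  then show ?thesis
    by (rule has_vector_derivative_transform[OF t e, rotated])
qed

text \<open>Order \<open>1 + a\<close> arises from order \<open>a\<close> by ordinary integration.\<close>

lemma volterra_ml_derivative:
  assumes "geometrically_bounded c" "\<rho> > 0" "a > 0" "T > 0" "continuous_on {0..T} f" and t: "t \<in> {0..T}"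
  shows "(volterra (ml_kernel c \<rho> (1 + a)) f has_vector_derivative volterra (ml_kernel c \<rho> a) f t)
           (at t within {0..T})"
  by (rule has_vector_derivative_transform[OF t _
        volterra_rl_one_derivative[OF volterra_ml_continuous[OF assms(1-5)] t]])
     (use volterra_rl_ml_kernel[OF assms(1-3) _ assms(4,5)] in auto)

section \<open>Injectivity of the Prabhakar operator\<close>

lemma zero_derivative_on_interval:
  fixes g :: "real \<Rightarrow> complex"
  assumes "T > 0" "\<And>t. t \<in> {0..T} \<Longrightarrow> g t = 0" "t \<in> {0..T}"
    "(g has_vector_derivative d) (at t within {0..T})"
  shows "d = 0"
proof -
  have "((\<lambda>_. 0) has_vector_derivative d) (at t within {0..T})"
    by (rule has_vector_derivative_transform[OF assms(3) _ assms(4)]) (use assms(2) in simp)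
  moreover have "at t within {0..T} \<noteq> bot"
    using assms(1,3) by (simp add: trivial_limit_within islimpt_Icc)
  ultimately show ?thesis
    using vector_derivative_unique_within has_vector_derivative_const by metis
qed

text \<open>
  At order one the leading term of the kernel is the constant \<open>1\<close>, and the rest is the integral of a
  weakly singular kernel \<open>Q\<close> of order \<open>\<rho>\<close>. Hence the operator is integration after \<open>I + V\<^sub>Q\<close>, and
  both factors are injective.
\<close>

lemma volterra_ml_one_injective:
  assumes c: "geometrically_bounded c" "c 0 = 1" and pos: "\<rho> > 0" "T > 0"
    and f: "continuous_on {0..T} f"
    and zero: "\<And>t. t \<in> {0..T} \<Longrightarrow> volterra (ml_kernel c \<rho> 1) f t = 0" and t: "t \<in> {0..T}"
  shows "f t = 0"
proof -
  let ?c = "\<lambda>n. c (Suc n)"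
  note c' = geometrically_bounded_shift[OF c(1)]
  obtain C where Q: "weakly_singular T \<rho> C (ml_kernel ?c \<rho> \<rho>)"
    using weakly_singular_ml_kernel[OF c' pos(1) pos] by blast
  obtain C' where Q': "weakly_singular T (1 + \<rho>) C' (ml_kernel ?c \<rho> (1 + \<rho>))"
    using weakly_singular_ml_kernel[OF c' pos(1) _ pos(2), of "1 + \<rho>"] pos by auto
  note Qf = volterra_ml_continuous[OF c' pos(1) pos f]
  have split: "ml_kernel c \<rho> 1 t s = rl_kernel 1 t s + ml_kernel ?c \<rho> (1 + \<rho>) t s" if "s < t" for t s
  proof -
    have e: "\<rho> * real (Suc n) + 1 = \<rho> * real n + (1 + \<rho>)" for n by (simp add: algebra_simps)
    have "(\<lambda>n. c (Suc n) * of_real ((t - s) powr (\<rho> * real (Suc n) + 1 - 1) / Gamma (\<rho> * real (Suc n) + 1)))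
        sums ml_kernel ?c \<rho> (1 + \<rho>) t s"
      unfolding e using ml_kernel_sums(1)[OF c' pos(1) _ that, of "1 + \<rho>"] pos by simp
    then have "(\<lambda>n. c n * of_real ((t - s) powr (\<rho> * real n + 1 - 1) / Gamma (\<rho> * real n + 1)))
        sums (ml_kernel ?c \<rho> (1 + \<rho>) t s + c 0 * of_real ((t - s) powr (\<rho> * real 0 + 1 - 1) / Gamma (\<rho> * real 0 + 1)))"
      by (subst (asm) sums_Suc_iff)
    from sums_unique2[OF this ml_kernel_sums(1)[OF c(1) pos(1) _ that]]
    show ?thesis using c(2) by (simp add: rl_kernel_def add.commute)
  qed
  have z: "volterra (rl_kernel 1) (\<lambda>s. f s + volterra (ml_kernel ?c \<rho> \<rho>) f s) u = 0"
    if u: "u \<in> {0..T}" for u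
  proof -
    have u': "0 \<le> u" "u \<le> T" using u by auto
    note R = weakly_singular_rl_kernel[of 1 T]
    have "volterra (rl_kernel 1) (\<lambda>s. f s + volterra (ml_kernel ?c \<rho> \<rho>) f s) u
       = volterra (rl_kernel 1) f u + volterra (ml_kernel ?c \<rho> (1 + \<rho>)) f u"
      using volterra_add[OF R f Qf u'] volterra_rl_ml_kernel[OF c' pos(1) pos(1) _ pos(2) f u', of 1] by simp
    also have "\<dots> = (LINT s|lborel. cut T (rl_kernel 1) u s * f s + cut T (ml_kernel ?c \<rho> (1 + \<rho>)) u s * f s)"
      unfolding volterra_eq_cut[OF u']
      by (rule Bochner_Integration.integral_add[symmetric])
         (use cut_mult_integrable(1)[OF R f] cut_mult_integrable(1)[OF Q' f] in auto)
    also have "\<dots> = volterra (ml_kernel c \<rho> 1) f u"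
      unfolding volterra_eq_cut[OF u']
      by (rule Bochner_Integration.integral_cong[OF refl]) (auto simp: cut_def split distrib_right)
    also have "\<dots> = 0" by (rule zero[OF u])
    finally show ?thesis .
  qed
  have "f s + volterra (ml_kernel ?c \<rho> \<rho>) f s = 0" if "s \<in> {0..T}" for s
    by (rule zero_derivative_on_interval[OF pos(2) z that volterra_rl_one_derivative])
       (use f Qf that in \<open>auto intro: continuous_intros\<close>)
  then show ?thesis by (rule volterra_homogeneous_unique[OF Q pos(2) f _ t])
qed

text \<open>
  Fractional integration raises the order to an integer, at least one; differentiation then lowers it
  to one.
\<close>

theorem volterra_ml_injective:
  assumes c: "geometrically_bounded c" "c 0 = 1" and pos: "\<rho> > 0" "a > 0" "T > 0"
    and f: "continuous_on {0..T} f"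
    and zero: "\<And>t. t \<in> {0..T} \<Longrightarrow> volterra (ml_kernel c \<rho> a) f t = 0" and t: "t \<in> {0..T}"
  shows "f t = 0"
proof -
  have nat: "f t = 0" if "\<And>t. t \<in> {0..T} \<Longrightarrow> volterra (ml_kernel c \<rho> (real (Suc n))) f t = 0" for n
    using that
  proof (induction n)
    case 0
    show ?case by (rule volterra_ml_one_injective[OF c pos(1,3) f _ t]) (use 0 in simp)
  next
    case (Suc n)
    have e: "real (Suc (Suc n)) = 1 + real (Suc n)" by simp
    show ?case
    proof (rule Suc.IH)
      fix s assume s: "s \<in> {0..T}"
      show "volterra (ml_kernel c \<rho> (real (Suc n))) f s = 0"
        by (rule zero_derivative_on_interval[OF pos(3) _ s volterra_ml_derivative[OF c(1) pos(1) _ pos(3) f s]])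
           (use Suc.prems[unfolded e] in auto)
    qed
  qed
  obtain n :: nat where n: "a < real n" using reals_Archimedean2 by blast
  show ?thesis
  proof (rule nat[of n])
    fix s assume s: "s \<in> {0..T}"
    define \<alpha> where "\<alpha> = real (Suc n) - a"
    have \<alpha>: "\<alpha> > 0" "\<alpha> + a = real (Suc n)" using n by (auto simp: \<alpha>_def)
    have "volterra (ml_kernel c \<rho> (\<alpha> + a)) f s = volterra (rl_kernel \<alpha>) (volterra (ml_kernel c \<rho> a) f) s"
      using volterra_rl_ml_kernel[OF c(1) pos(1,2) \<alpha>(1) pos(3) f] s by simp
    also have "\<dots> = volterra (rl_kernel \<alpha>) (\<lambda>_. 0) s"
      by (rule volterra_cong) (use zero s in auto)
    also have "\<dots> = 0" by (simp add: volterra_def set_lebesgue_integral_def)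
    finally show "volterra (ml_kernel c \<rho> (real (Suc n))) f s = 0" unfolding \<alpha>(2) .
  qed
qed

section \<open>Sums and multiples of weakly singular kernels\<close>

lemma weakly_singular_mono:
  assumes G: "weakly_singular T \<eta> C G" and "0 < \<theta>" "\<theta> \<le> \<eta>"
  shows "weakly_singular T \<theta> (C * T powr (\<eta> - \<theta>)) G"
proof -
  note D = weakly_singularD[OF G]
  have "norm (G t s) \<le> C * T powr (\<eta> - \<theta>) * (t - s) powr (\<theta> - 1)"
    if ts: "0 \<le> s" "s < t" "t \<le> T" for t s
  proof -
    have "(t - s) powr (\<eta> - 1) = (t - s) powr (\<eta> - \<theta>) * (t - s) powr (\<theta> - 1)"
      by (simp flip: powr_add)
    also have "\<dots> \<le> T powr (\<eta> - \<theta>) * (t - s) powr (\<theta> - 1)"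
      using ts assms by (intro mult_right_mono powr_mono2) auto
    finally have "C * (t - s) powr (\<eta> - 1) \<le> C * (T powr (\<eta> - \<theta>) * (t - s) powr (\<theta> - 1))"
      using D(2) by (rule mult_left_mono)
    with D(4)[OF ts] show ?thesis by (simp add: mult.assoc)
  qed
  then show ?thesis unfolding weakly_singular_def using D assms by auto
qed

lemma weakly_singular_add:
  assumes G: "weakly_singular T \<eta> C G" and H: "weakly_singular T \<theta> D H"
  shows "\<exists>\<kappa> E. weakly_singular T \<kappa> E (\<lambda>t s. G t s + H t s)"
proof -
  define \<kappa> where "\<kappa> = min \<eta> \<theta>"
  have \<kappa>: "0 < \<kappa>" "\<kappa> \<le> \<eta>" "\<kappa> \<le> \<theta>"
    using weakly_singularD(1)[OF G] weakly_singularD(1)[OF H] by (auto simp: \<kappa>_def)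
  obtain A B where A: "weakly_singular T \<kappa> A G" and B: "weakly_singular T \<kappa> B H"
    using weakly_singular_mono[OF G \<kappa>(1,2)] weakly_singular_mono[OF H \<kappa>(1,3)] by blast
  note a = weakly_singularD[OF A] and b = weakly_singularD[OF B]
  note [measurable] = a(3) b(3)
  have "(\<lambda>p. case_prod (cut T G) p + case_prod (cut T H) p) \<in> borel_measurable (borel \<Otimes>\<^sub>M borel)"
    by measurable
  also have "(\<lambda>p. case_prod (cut T G) p + case_prod (cut T H) p) = case_prod (cut T (\<lambda>t s. G t s + H t s))"
    by (auto simp: cut_def fun_eq_iff)
  finally have m: "case_prod (cut T (\<lambda>t s. G t s + H t s)) \<in> borel_measurable (borel \<Otimes>\<^sub>M borel)" .
  have "norm (G t s + H t s) \<le> (A + B) * (t - s) powr (\<kappa> - 1)"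
    if ts: "0 \<le> s" "s < t" "t \<le> T" for t s
    using norm_triangle_le[OF add_mono[OF a(4)[OF ts] b(4)[OF ts]]] by (simp add: distrib_right)
  then have "weakly_singular T \<kappa> (A + B) (\<lambda>t s. G t s + H t s)"
    unfolding weakly_singular_def using m a b by auto
  then show ?thesis by blast
qed

lemma weakly_singular_mult_left:
  assumes G: "weakly_singular T \<eta> C G" and p: "continuous_on {0..T} p"
  shows "\<exists>D. weakly_singular T \<eta> D (\<lambda>t s. p t * G t s)"
proof -
  note D = weakly_singularD[OF G]
  obtain M where M: "M \<ge> 0" "\<forall>s\<in>{0..T}. norm (p s) \<le> M"
    using continuous_on_bounded_measurable(2)[OF p] by blast
  note [measurable] = D(3) continuous_on_bounded_measurable(1)[OF p]
  have "(\<lambda>x. (\<lambda>t. indicator {0..T} t *\<^sub>R p t) (fst x) * case_prod (cut T G) x)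
      \<in> borel_measurable (borel \<Otimes>\<^sub>M borel)"
    by measurable
  also have "(\<lambda>x. (\<lambda>t. indicator {0..T} t *\<^sub>R p t) (fst x) * case_prod (cut T G) x)
      = case_prod (cut T (\<lambda>t s. p t * G t s))"
    by (auto simp: cut_def fun_eq_iff)
  finally have m: "case_prod (cut T (\<lambda>t s. p t * G t s)) \<in> borel_measurable (borel \<Otimes>\<^sub>M borel)" .
  have "norm (p t * G t s) \<le> M * C * (t - s) powr (\<eta> - 1)"
    if ts: "0 \<le> s" "s < t" "t \<le> T" for t s
    using mult_mono[OF _ D(4)[OF ts], of "norm (p t)" M] M ts by (simp add: norm_mult mult.assoc)
  then have "weakly_singular T \<eta> (M * C) (\<lambda>t s. p t * G t s)"
    unfolding weakly_singular_def using m D M by auto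
  then show ?thesis by blast
qed

lemma weakly_singular_zero: "weakly_singular T 1 0 (\<lambda>t s. 0)"
proof -
  have "case_prod (cut T (\<lambda>t s. 0)) = (\<lambda>_. 0)" by (auto simp: cut_def fun_eq_iff)
  then show ?thesis by (simp add: weakly_singular_def)
qed

lemma weakly_singular_sum:
  assumes "finite J" "\<And>j. j \<in> J \<Longrightarrow> \<exists>\<eta> C. weakly_singular T \<eta> C (G j)"
  shows "\<exists>\<eta> C. weakly_singular T \<eta> C (\<lambda>t s. \<Sum>j\<in>J. G j t s)"
  using assms
proof (induction J rule: finite_induct)
  case empty
  then show ?case using weakly_singular_zero by auto
next
  case (insert j J)
  obtain \<eta> C where "weakly_singular T \<eta> C (G j)" using insert.prems by blast
  moreover obtain \<theta> D where "weakly_singular T \<theta> D (\<lambda>t s. \<Sum>j\<in>J. G j t s)"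
    using insert.IH insert.prems by blast
  ultimately show ?case
    using weakly_singular_add[of T \<eta> C "G j" \<theta> D "\<lambda>t s. \<Sum>j\<in>J. G j t s"] insert.hyps by simp
qed

lemma weakly_singular_continuous_kernel:
  assumes "continuous_on {(t, s). 0 \<le> s \<and> s \<le> t \<and> t \<le> T} (\<lambda>(t, s). K t s)"
  shows "\<exists>C. weakly_singular T 1 C K"
    and "continuous_on {(t, s). 0 \<le> s \<and> s < t \<and> t \<le> T} (\<lambda>(t, s). K t s)"
proof -
  let ?S = "{(t, s). 0 \<le> s \<and> s \<le> t \<and> t \<le> T}"
  have eq: "?S = ({0..T} \<times> {0..T}) \<inter> {p. snd p \<le> fst p}" by auto
  have "compact ?S"
    unfolding eq by (intro compact_Int_closed compact_Times compact_Icc closed_Collect_le continuous_intros)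
  then have "bounded ((\<lambda>(t, s). K t s) ` ?S)"
    using assms by (intro compact_imp_bounded compact_continuous_image)
  then obtain M where M: "\<And>p. p \<in> ?S \<Longrightarrow> norm ((\<lambda>(t, s). K t s) p) \<le> M"
    by (auto simp: bounded_iff)
  show c: "continuous_on {(t, s). 0 \<le> s \<and> s < t \<and> t \<le> T} (\<lambda>(t, s). K t s)"
    by (rule continuous_on_subset[OF assms]) auto
  have "weakly_singular T 1 (max M 0) K"
    by (rule weakly_singular_continuousI[OF _ _ c]) (use M[of "(_, _)"] in \<open>auto simp: le_max_iff_disj\<close>)
  then show "\<exists>C. weakly_singular T 1 C K" ..
qed

section \<open>The polynomial part and the density of a function\<close>

definition prabhakar_coeff :: "complex \<Rightarrow> complex \<Rightarrow> nat \<Rightarrow> complex" where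
  "prabhakar_coeff \<gamma> \<omega> n = pochhammer \<gamma> n / fact n * \<omega> ^ n"

lemma prabhakar_coeff_0: "prabhakar_coeff \<gamma> \<omega> 0 = 1"
  by (simp add: prabhakar_coeff_def)

text \<open>Each ratio \<open>(\<gamma> + n) / (n + 1)\<close> has modulus at most \<open>1 + |\<gamma>|\<close>.\<close>

lemma geometrically_bounded_prabhakar_coeff: "geometrically_bounded (prabhakar_coeff \<gamma> \<omega>)"
proof -
  have *: "norm (pochhammer \<gamma> n / fact n) \<le> (1 + norm \<gamma>) ^ n" for n
  proof (induction n)
    case (Suc n)
    have "norm (\<gamma> + of_nat n) / real (Suc n) \<le> 1 + norm \<gamma>"
    proof -
      have "norm (\<gamma> + of_nat n) \<le> norm \<gamma> + real n"
        using norm_triangle_ineq[of \<gamma> "of_nat n"] by simp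
      also have "\<dots> \<le> (1 + norm \<gamma>) * real (Suc n)" by (simp add: algebra_simps)
      finally show ?thesis by (simp add: divide_le_eq)
    qed
    moreover have "norm (pochhammer \<gamma> (Suc n) / fact (Suc n))
        = norm (pochhammer \<gamma> n / fact n) * (norm (\<gamma> + of_nat n) / real (Suc n))"
      by (simp add: pochhammer_Suc norm_mult norm_divide mult.commute del: of_nat_Suc)
    ultimately show ?case
      using mult_mono[OF Suc.IH, of "norm (\<gamma> + of_nat n) / real (Suc n)" "1 + norm \<gamma>"]
      by (simp add: mult.commute del: of_nat_Suc)
  qed simp
  have "norm (prabhakar_coeff \<gamma> \<omega> n) \<le> 1 * ((1 + norm \<gamma>) * norm \<omega>) ^ n" for n
    using mult_right_mono[OF *[of n], of "norm \<omega> ^ n"]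
    by (simp add: prabhakar_coeff_def norm_mult norm_divide norm_power power_mult_distrib)
  then show ?thesis unfolding geometrically_bounded_def
    by (intro exI[of _ 1] conjI exI[of _ "(1 + norm \<gamma>) * norm \<omega>"]) auto
qed

abbreviation prabhakar_ml :: "real \<Rightarrow> complex \<Rightarrow> complex \<Rightarrow> real \<Rightarrow> real \<Rightarrow> real \<Rightarrow> complex" where
  "prabhakar_ml \<rho> \<omega> \<gamma> \<equiv> ml_kernel (prabhakar_coeff \<gamma> \<omega>) \<rho>"

lemma prabhakar_kernel_eq: "prabhakar_kernel \<rho> a \<omega> \<gamma> (t - s) = prabhakar_ml \<rho> \<omega> \<gamma> a t s"
  unfolding prabhakar_kernel_def ml_kernel_def mittag_leffler3_def ml_series_def prabhakar_coeff_def
  by (simp add: power_mult_distrib field_simps)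

lemma prabhakar_eq_volterra: "prabhakar \<rho> a \<omega> \<gamma> f t = volterra (prabhakar_ml \<rho> \<omega> \<gamma> a) f t"
  unfolding prabhakar_def volterra_def prabhakar_kernel_eq ..

lemmas prabhakar_ml_weakly_singular = weakly_singular_ml_kernel[OF geometrically_bounded_prabhakar_coeff]
lemmas prabhakar_ml_continuous = volterra_ml_continuous[OF geometrically_bounded_prabhakar_coeff]

lemma volterra_at_0: "volterra G f 0 = 0"
proof -
  have "cut 0 G 0 = (\<lambda>_. 0)" by (auto simp: cut_def fun_eq_iff)
  then show ?thesis by (simp add: volterra_eq_cut[of 0 0])
qed

text \<open>
  For \<open>k < m\<close> the order \<open>\<mu> - k\<close> is still positive because \<open>\<mu> > m - 1\<close>; so \<open>k\<close> derivatives may be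
  taken under the Prabhakar operator, each lowering its order by one.
\<close>

lemma decomposition_derivatives:
  assumes u: "decomposes T m \<rho> \<mu> \<omega> \<gamma> u P v"
    and T: "T > 0" and \<rho>: "\<rho> > 0" and \<mu>: "real m - 1 < \<mu>"
  defines "D \<equiv> \<lambda>k t. poly ((pderiv ^^ k) P) (of_real t) + volterra (prabhakar_ml \<rho> \<omega> \<gamma> (\<mu> - real k)) v t"
  shows "k < m \<Longrightarrow> t \<in> {0..T} \<Longrightarrow> (deriv_on T ^^ k) u t = D k t"
    and "Suc k < m \<Longrightarrow> t \<in> {0..T} \<Longrightarrow>
           ((deriv_on T ^^ k) u has_vector_derivative D (Suc k) t) (at t within {0..T})"
    and "k < m \<Longrightarrow> continuous_on {0..T} (D k)"
proof -
  have v: "continuous_on {0..T} v" using u by (simp add: decomposes_def)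
  have D: "(D k has_vector_derivative D (Suc k) t) (at t within {0..T})"
    if k: "Suc k < m" and t: "t \<in> {0..T}" for k t
  proof -
    have pos: "\<mu> - real (Suc k) > 0" using k \<mu> by linarith
    have e: "1 + (\<mu> - real (Suc k)) = \<mu> - real k" by simp
    have "((\<lambda>t. poly ((pderiv ^^ k) P) (complex_of_real t)) has_vector_derivative
        poly ((pderiv ^^ Suc k) P) (of_real t)) (at t within {0..T})"
      by (rule has_vector_derivative_real_field) (simp add: poly_DERIV)
    from has_vector_derivative_add[OF this volterra_ml_derivative
        [OF geometrically_bounded_prabhakar_coeff \<rho> pos T v t, unfolded e]]
    show ?thesis unfolding D_def .
  qed
  show "continuous_on {0..T} (D k)" if "k < m" for k
    unfolding D_def
    by (rule continuous_on_add[OF _ prabhakar_ml_continuous[OF \<rho> _ T v]])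
       (use that \<mu> in \<open>auto intro!: continuous_intros\<close>)
  have transfer: "((deriv_on T ^^ k) u has_vector_derivative D (Suc k) t) (at t within {0..T})"
    if "\<And>t. t \<in> {0..T} \<Longrightarrow> (deriv_on T ^^ k) u t = D k t" "Suc k < m" "t \<in> {0..T}" for k t
    by (rule has_vector_derivative_transform[OF that(3) that(1) D[OF that(2,3)]])
  have eq: "(deriv_on T ^^ k) u t = D k t" if "k < m" "t \<in> {0..T}" for k t
    using that
  proof (induction k arbitrary: t)
    case 0
    then show ?case using u by (simp add: decomposes_def D_def prabhakar_eq_volterra)
  next
    case (Suc k)
    have "((deriv_on T ^^ k) u has_vector_derivative D (Suc k) t) (at t within {0..T})"
      using Suc by (intro transfer) auto
    then have "vector_derivative ((deriv_on T ^^ k) u) (at t within {0..T}) = D (Suc k) t"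
      using vector_derivative_within_cbox[of 0 T t] T Suc.prems by simp
    then show ?case by (simp add: deriv_on_def[of T "(deriv_on T ^^ k) u"])
  qed
  then show "k < m \<Longrightarrow> t \<in> {0..T} \<Longrightarrow> (deriv_on T ^^ k) u t = D k t" .
  show "Suc k < m \<Longrightarrow> t \<in> {0..T} \<Longrightarrow>
      ((deriv_on T ^^ k) u has_vector_derivative D (Suc k) t) (at t within {0..T})"
    using eq by (intro transfer) auto
qed

text \<open>Volterra integrals vanish at \<open>0\<close>, so only the polynomial contributes to the jet.\<close>

lemma decomposition_jet:
  assumes u: "decomposes T m \<rho> \<mu> \<omega> \<gamma> u P v"
    and T: "T > 0" and \<rho>: "\<rho> > 0" and \<mu>: "real m - 1 < \<mu>"
    and d: "\<And>k. k < m \<Longrightarrow> d k = fact k * coeff P k"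
  shows "has_initial_jet T m u d"
proof -
  note D = decomposition_derivatives[OF u T \<rho> \<mu>]
  have m: "m > 0" using u by (simp add: decomposes_def)
  have "continuous_on {0..T} ((deriv_on T ^^ k) u)" if "k < m" for k
    by (rule continuous_on_cong[THEN iffD1, OF refl _ D(3)[OF that]]) (use D(1)[OF that] in simp)
  moreover have "(deriv_on T ^^ k) u differentiable (at t within {0..T})"
    if "Suc k < m" "t \<in> {0..T}" for k t
    using D(2)[OF that] by (rule differentiableI_vector)
  moreover have "(deriv_on T ^^ k) u 0 = d k" if "k < m" for k
    using D(1)[OF that, of 0] T
    by (simp add: volterra_at_0 poly_0_coeff_0 coeff_higher_pderiv d[OF that] flip: pochhammer_fact)
  ultimately show ?thesis using m unfolding has_initial_jet_def C_k_on_def by auto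
qed

text \<open>The jet determines the polynomial; injectivity then determines the density.\<close>

lemma decomposition_unique:
  assumes u: "decomposes T m \<rho> \<mu> \<omega> \<gamma> u P v" and u': "decomposes T m \<rho> \<mu> \<omega> \<gamma> u Q w"
    and T: "T > 0" and \<rho>: "\<rho> > 0" and \<mu>: "real m - 1 < \<mu>"
  shows "P = Q" "\<And>t. t \<in> {0..T} \<Longrightarrow> v t = w t"
proof -
  have m: "m > 0" using u by (simp add: decomposes_def)
  have deg: "degree P < m" "degree Q < m" and cont: "continuous_on {0..T} v" "continuous_on {0..T} w"
    using u u' by (auto simp: decomposes_def)
  have "has_initial_jet T m u (\<lambda>k. fact k * coeff P k)" "has_initial_jet T m u (\<lambda>k. fact k * coeff Q k)"
    using decomposition_jet[OF u T \<rho> \<mu>] decomposition_jet[OF u' T \<rho> \<mu>] by auto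
  then have "fact k * coeff P k = fact k * coeff Q k" if "k < m" for k
    using that unfolding has_initial_jet_def by metis
  then have "coeff P k = coeff Q k" for k
    using deg by (cases "k < m") (auto simp: coeff_eq_0)
  then show PQ: "P = Q" by (rule poly_eqI)
  have pos: "\<mu> > 0" using \<mu> m by linarith
  obtain C where R: "weakly_singular T \<mu> C (prabhakar_ml \<rho> \<omega> \<gamma> \<mu>)"
    using prabhakar_ml_weakly_singular[OF \<rho> pos T] by blast
  have z: "volterra (prabhakar_ml \<rho> \<omega> \<gamma> \<mu>) (\<lambda>s. v s - w s) t = 0" if "t \<in> {0..T}" for t
    using u u' that unfolding decomposes_def PQ
    by (subst volterra_diff[OF R cont]) (auto simp: prabhakar_eq_volterra)
  fix t assume "t \<in> {0..T}"
  then have "v t - w t = 0"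
    using volterra_ml_injective[OF geometrically_bounded_prabhakar_coeff prabhakar_coeff_0 \<rho> pos T _ z, of t]
      cont by (auto intro: continuous_intros)
  then show "v t = w t" by simp
qed

text \<open>By uniqueness of the decomposition, the value of \<open>components\<close> does not depend on how it is chosen.\<close>

lemma components_decomposition:
  assumes u: "decomposes T m \<rho> \<mu> \<omega> \<gamma> u P v"
    and T: "T > 0" and \<rho>: "\<rho> > 0" and \<mu>: "real m - 1 < \<mu>"
  shows "fst (components T m \<rho> \<mu> \<omega> \<gamma> u) = P"
    "\<And>t. t \<in> {0..T} \<Longrightarrow> snd (components T m \<rho> \<mu> \<omega> \<gamma> u) t = v t"
proof -
  have "case components T m \<rho> \<mu> \<omega> \<gamma> u of (Q, w) \<Rightarrow> decomposes T m \<rho> \<mu> \<omega> \<gamma> u Q w"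
    unfolding components_def by (rule someI[of _ "(P, v)"]) (simp add: u)
  then have c: "decomposes T m \<rho> \<mu> \<omega> \<gamma> u (fst (components T m \<rho> \<mu> \<omega> \<gamma> u)) (snd (components T m \<rho> \<mu> \<omega> \<gamma> u))"
    by (simp add: case_prod_unfold)
  show "fst (components T m \<rho> \<mu> \<omega> \<gamma> u) = P"
    by (rule decomposition_unique(1)[OF c u T \<rho> \<mu>])
  show "\<And>t. t \<in> {0..T} \<Longrightarrow> snd (components T m \<rho> \<mu> \<omega> \<gamma> u) t = v t"
    by (rule decomposition_unique(2)[OF c u T \<rho> \<mu>])
qed

section \<open>Reduction to a Volterra equation\<close>

lemma caputo_poly_continuous:
  assumes "\<beta> \<ge> 0"
  shows "continuous_on {0..T} (caputo_poly \<beta> P)"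
proof -
  have "continuous_on {0..T} (caputo_monomial \<beta> k)" for k
  proof (cases "int k < \<lceil>\<beta>\<rceil> \<or> real k = \<beta>")
    case True
    then have "caputo_monomial \<beta> k = (\<lambda>_. if int k < \<lceil>\<beta>\<rceil> then 0 else 1)"
      by (auto simp: caputo_monomial_def fun_eq_iff)
    then show ?thesis by simp
  next
    case False
    then have k: "real k > \<beta>" by linarith
    have "caputo_monomial \<beta> k = (\<lambda>t. of_real (t powr (real k - \<beta>) / Gamma (real k + 1 - \<beta>)))"
      using False by (auto simp: caputo_monomial_def fun_eq_iff)
    moreover have "Gamma (real k + 1 - \<beta>) > 0" using k by (intro Gamma_real_pos) auto
    moreover have "continuous_on {0..T} (\<lambda>t. t powr (real k - \<beta>))"
      using k by (intro continuous_on_powr' continuous_intros) auto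
    ultimately show ?thesis
      by (auto intro!: continuous_on_of_real continuous_on_divide continuous_on_const)
  qed
  then show ?thesis unfolding caputo_poly_def[abs_def] by (intro continuous_intros)
qed

lemma reduced_kernel_eq:
  "reduced_kernel \<rho> \<mu> \<omega> \<gamma> N p \<beta> K t s =
     (\<Sum>j=1..N. p j t * prabhakar_ml \<rho> \<omega> \<gamma> (\<mu> - \<beta> j) t s) + kernel_comp K (prabhakar_ml \<rho> \<omega> \<gamma> \<mu>) t s"
  unfolding reduced_kernel_def kernel_comp_def prabhakar_kernel_eq ..

text \<open>
  Continuity of the image of \<open>v\<close> comes from the operator identity, each of whose terms is continuous.
\<close>

lemma reduced_kernel_volterra:
  fixes \<omega> \<gamma> :: complex
  assumes T: "T > 0" and \<mu>: "\<mu> > 0" and \<rho>: "\<rho> > 0"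
    and \<beta>: "\<forall>j\<in>{1..N}. 0 \<le> \<beta> j \<and> \<beta> j < \<mu>"
    and p: "\<forall>j\<in>{1..N}. continuous_on {0..T} (p j)"
    and K: "continuous_on {(t, s). 0 \<le> s \<and> s \<le> t \<and> t \<le> T} (\<lambda>(t, s). K t s)"
  defines "G \<equiv> reduced_kernel \<rho> \<mu> \<omega> \<gamma> N p \<beta> K"
  shows reduced_kernel_weakly_singular: "\<exists>\<eta> C. weakly_singular T \<eta> C G"
    and volterra_reduced_kernel: "\<And>v t. continuous_on {0..T} v \<Longrightarrow> t \<in> {0..T} \<Longrightarrow>
      volterra G v t = (\<Sum>j=1..N. p j t * volterra (prabhakar_ml \<rho> \<omega> \<gamma> (\<mu> - \<beta> j)) v t)
         + volterra K (volterra (prabhakar_ml \<rho> \<omega> \<gamma> \<mu>) v) t"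
    and volterra_reduced_kernel_continuous:
      "\<And>v. continuous_on {0..T} v \<Longrightarrow> continuous_on {0..T} (volterra G v)"
proof -
  let ?k = "prabhakar_ml \<rho> \<omega> \<gamma>"
  obtain D where K1: "weakly_singular T 1 D K" using weakly_singular_continuous_kernel(1)[OF K] by blast
  note K2 = weakly_singular_continuous_kernel(2)[OF K]
  obtain C where R: "weakly_singular T \<mu> C (?k \<mu>)"
    using prabhakar_ml_weakly_singular[OF \<rho> \<mu> T] by blast
  have Rj: "\<exists>C. weakly_singular T (\<mu> - \<beta> j) C (?k (\<mu> - \<beta> j))" if "j \<in> {1..N}" for j
    using prabhakar_ml_weakly_singular[OF \<rho> _ T] \<beta>[rule_format, OF that] by simp
  note KR = weakly_singular_kernel_comp[OF K1 R]
  have "\<exists>\<eta> C. weakly_singular T \<eta> C (\<lambda>t s. p j t * ?k (\<mu> - \<beta> j) t s)" if j: "j \<in> {1..N}" for j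
  proof -
    obtain C where "weakly_singular T (\<mu> - \<beta> j) C (?k (\<mu> - \<beta> j))" using Rj[OF j] by blast
    from weakly_singular_mult_left[OF this p[rule_format, OF j]] show ?thesis by blast
  qed
  then obtain \<eta> E where "weakly_singular T \<eta> E (\<lambda>t s. \<Sum>j=1..N. p j t * ?k (\<mu> - \<beta> j) t s)"
    using weakly_singular_sum[of "{1..N}" T "\<lambda>j t s. p j t * ?k (\<mu> - \<beta> j) t s"] by auto
  from weakly_singular_add[OF this KR]
  show "\<exists>\<eta> C. weakly_singular T \<eta> C G"
    unfolding G_def reduced_kernel_eq[abs_def] by simp
  show V: "volterra G v t = (\<Sum>j=1..N. p j t * volterra (?k (\<mu> - \<beta> j)) v t) + volterra K (volterra (?k \<mu>) v) t"
    if v: "continuous_on {0..T} v" and t: "t \<in> {0..T}" for v t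
  proof -
    have t': "0 \<le> t" "t \<le> T" using t by auto
    have i: "integrable lborel (\<lambda>s. p j t * (cut T (?k (\<mu> - \<beta> j)) t s * v s))" if j: "j \<in> {1..N}" for j
      using Rj[OF j] cut_mult_integrable(1)[OF _ v] by (intro integrable_mult_right) blast
    have "volterra G v t = (LINT s|lborel. (\<Sum>j=1..N. p j t * (cut T (?k (\<mu> - \<beta> j)) t s * v s))
        + cut T (kernel_comp K (?k \<mu>)) t s * v s)"
      unfolding volterra_eq_cut[OF t']
      by (rule Bochner_Integration.integral_cong[OF refl])
         (auto simp: cut_def G_def reduced_kernel_eq distrib_right sum_distrib_right mult.assoc)
    also have "\<dots> = (LINT s|lborel. (\<Sum>j=1..N. p j t * (cut T (?k (\<mu> - \<beta> j)) t s * v s)))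
        + (LINT s|lborel. cut T (kernel_comp K (?k \<mu>)) t s * v s)"
      by (intro Bochner_Integration.integral_add Bochner_Integration.integrable_sum i
          cut_mult_integrable(1)[OF KR v])
    also have "(LINT s|lborel. (\<Sum>j=1..N. p j t * (cut T (?k (\<mu> - \<beta> j)) t s * v s)))
        = (\<Sum>j=1..N. p j t * volterra (?k (\<mu> - \<beta> j)) v t)"
      using i by (subst Bochner_Integration.integral_sum) (auto simp: volterra_eq_cut[OF t'])
    also have "(LINT s|lborel. cut T (kernel_comp K (?k \<mu>)) t s * v s) = volterra K (volterra (?k \<mu>) v) t"
      using volterra_kernel_comp[OF K1 R v t'] by (simp add: volterra_eq_cut[OF t'])
    finally show ?thesis .
  qed
  show "continuous_on {0..T} (volterra G v)" if v: "continuous_on {0..T} v" for v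
  proof -
    have "continuous_on {0..T} (\<lambda>t. (\<Sum>j=1..N. p j t * volterra (?k (\<mu> - \<beta> j)) v t)
        + volterra K (volterra (?k \<mu>) v) t)"
      by (intro continuous_on_add continuous_on_sum continuous_on_mult p[rule_format]
          volterra_continuous[OF K1 T K2] prabhakar_ml_continuous[OF \<rho> _ T v])
         (use \<beta> \<mu> in auto)
    then show ?thesis
      by (rule continuous_on_cong[THEN iffD1, OF refl, rotated]) (use V[OF v] in simp)
  qed
qed

lemma weakly_singular_admissible:
  assumes G: "weakly_singular T \<eta> C G"
    and pres: "\<And>f. continuous_on {0..T} f \<Longrightarrow> continuous_on {0..T} (volterra G f)"
  shows "admissible_kernel T G"
  unfolding admissible_kernel_def
proof (intro conjI allI impI ballI)
  note D = weakly_singularD[OF G]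
  have "(\<lambda>x. indicator {(t, s). 0 \<le> s \<and> s < t \<and> t \<le> T} x *\<^sub>R (\<lambda>(t, s). G t s) x) = case_prod (cut T G)"
    by (auto simp: fun_eq_iff cut_def indicator_def)
  then show "set_borel_measurable lborel {(t, s). 0 \<le> s \<and> s < t \<and> t \<le> T} (\<lambda>(t, s). G t s)"
    using D(3) unfolding set_borel_measurable_def by (simp add: borel_prod)
  show "set_integrable lborel {0..t} (\<lambda>s. G t s * f s)"
    if f: "continuous_on {0..T} f" and t: "t \<in> {0..T}" for f t
    unfolding set_integrable_def
  proof (rule lborel_finite_difference(2)[THEN iffD1])
    show "integrable lborel (\<lambda>s. cut T G t s * f s)" by (rule cut_mult_integrable(1)[OF G f])
    show "cut T G t s * f s = indicator {0..t} s *\<^sub>R (G t s * f s)" if "s \<notin> {t}" for s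
      using t that by (auto simp: cut_def indicator_def)
  qed simp
  have "norm (G t s) \<le> (C + 1) * (t - s) powr (\<eta> - 1)" if "0 \<le> s" "s < t" "t \<le> T" for t s
    using D(4)[OF that] by (simp add: distrib_right add_increasing2)
  then have "AE (t, s) in lborel. 0 \<le> s \<and> s < t \<and> t \<le> T \<longrightarrow> norm (G t s) \<le> (C + 1) * (t - s) powr (\<eta> - 1)"
    by (intro AE_I2) auto
  then show "\<exists>C>0. \<exists>\<eta>>0. AE (t, s) in lborel.
        0 \<le> s \<and> s < t \<and> t \<le> T \<longrightarrow> norm (G t s) \<le> C * (t - s) powr (\<eta> - 1)"
    using D(1,2) by (intro exI[of _ "C + 1"] conjI exI[of _ \<eta>]) auto
qed (rule pres)

text \<open>
  All terms that involve only the polynomial move to the right-hand side; those that involve the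
  density add up to the Volterra operator of the reduced kernel.
\<close>

lemma satisfies_equation_iff_volterra:
  assumes T: "T > 0" and \<mu>: "real m - 1 < \<mu>" "\<mu> > 0" and \<rho>: "\<rho> > 0"
    and \<beta>: "\<forall>j\<in>{1..N}. 0 \<le> \<beta> j \<and> \<beta> j < \<mu>"
    and p: "\<forall>j\<in>{1..N}. continuous_on {0..T} (p j)"
    and K: "continuous_on {(t, s). 0 \<le> s \<and> s \<le> t \<and> t \<le> T} (\<lambda>(t, s). K t s)"
    and u: "decomposes T m \<rho> \<mu> \<omega> \<gamma> u (jet_poly m d) v"
  shows "satisfies_equation T m \<rho> \<mu> \<omega> \<gamma> N p \<beta> K f u \<longleftrightarrow>
    (\<forall>t\<in>{0..T}. v t + volterra (reduced_kernel \<rho> \<mu> \<omega> \<gamma> N p \<beta> K) v t = reduced_rhs m N p \<beta> K f d t)"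
proof -
  let ?P = "jet_poly m d" and ?k = "prabhakar_ml \<rho> \<omega> \<gamma>"
  note comp = components_decomposition[OF u T \<rho> \<mu>(1)]
  have v: "continuous_on {0..T} v" using u by (simp add: decomposes_def)
  obtain D where K1: "weakly_singular T 1 D K" using weakly_singular_continuous_kernel(1)[OF K] by blast
  have "ext_deriv T m \<rho> \<mu> \<omega> \<gamma> u t + (\<Sum>j=1..N. p j t * ext_caputo T m \<rho> \<mu> \<omega> \<gamma> (\<beta> j) u t) + volterra K u t = f t
     \<longleftrightarrow> v t + volterra (reduced_kernel \<rho> \<mu> \<omega> \<gamma> N p \<beta> K) v t = reduced_rhs m N p \<beta> K f d t"
    if t: "t \<in> {0..T}" for t
  proof -
    have "ext_caputo T m \<rho> \<mu> \<omega> \<gamma> b u t = caputo_poly b ?P t + volterra (?k (\<mu> - b)) v t" for b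
      unfolding ext_caputo_def prabhakar_eq_volterra comp(1)
      using t comp(2) by (auto intro!: volterra_cong)
    moreover have "volterra K u t = volterra K (\<lambda>s. poly ?P (of_real s)) t + volterra K (volterra (?k \<mu>) v) t"
    proof -
      have "volterra K u t = volterra K (\<lambda>s. poly ?P (of_real s) + volterra (?k \<mu>) v s) t"
        using u t by (intro volterra_cong) (auto simp: decomposes_def prabhakar_eq_volterra)
      also have "\<dots> = volterra K (\<lambda>s. poly ?P (of_real s)) t + volterra K (volterra (?k \<mu>) v) t"
        by (rule volterra_add[OF K1 _ prabhakar_ml_continuous[OF \<rho> \<mu>(2) T v]])
           (use t in \<open>auto intro!: continuous_intros\<close>)
      finally show ?thesis .
    qed
    ultimately show ?thesis
      unfolding ext_deriv_def comp(2)[OF t] reduced_rhs_def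
        volterra_reduced_kernel[OF T \<mu>(2) \<rho> \<beta> p K v t]
      by (simp add: distrib_left sum.distrib algebra_simps)
  qed
  then show ?thesis unfolding satisfies_equation_def by blast
qed

lemma degree_jet_poly: "m \<ge> 1 \<Longrightarrow> degree (jet_poly m d) < m"
  unfolding jet_poly_def
  by (rule le_less_trans[OF degree_sum_le[of _ _ "m - 1"]])
     (auto intro: order_trans[OF degree_monom_le])

lemma coeff_jet_poly: "k < m \<Longrightarrow> coeff (jet_poly m d) k = d k / fact k"
  by (simp add: jet_poly_def coeff_sum)

theorem theorem5:
  fixes T \<rho> \<mu> :: real and \<gamma> \<omega> :: complex and m N :: nat
    and \<beta> :: "nat \<Rightarrow> real" and p :: "nat \<Rightarrow> real \<Rightarrow> complex" and K :: "real \<Rightarrow> real \<Rightarrow> complex"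
  assumes "T > 0" and "m \<ge> 1" and "real m - 1 < \<mu>" and "\<mu> < real m" and "\<rho> > 0"
    and "\<And>j. j \<in> {1..N} \<Longrightarrow> 0 \<le> \<beta> j \<and> \<beta> j < \<mu>"
    and "\<And>j. j \<in> {1..N} \<Longrightarrow> continuous_on {0..T} (p j)"
    and "continuous_on {(t, s). 0 \<le> s \<and> s \<le> t \<and> t \<le> T} (\<lambda>(t, s). K t s)"
  defines "G\<^sub>P \<equiv> reduced_kernel \<rho> \<mu> \<omega> \<gamma> N p \<beta> K"
  shows "admissible_kernel T G\<^sub>P \<and>
    (\<forall>f d. continuous_on {0..T} f \<longrightarrow>
      (let P = (\<lambda>t. poly (jet_poly m d) (complex_of_real t));
           F = reduced_rhs m N p \<beta> K f d;
           solution = (\<lambda>u. u \<in> slice T m \<rho> \<mu> \<omega> \<gamma> d \<and>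
              satisfies_equation T m \<rho> \<mu> \<omega> \<gamma> N p \<beta> K f u \<and> has_initial_jet T m u d)
       in (\<exists>u. solution u \<and>
             (\<forall>w. solution w \<longrightarrow> (\<forall>t\<in>{0..T}. w t = u t)) \<and>
             (\<forall>t\<in>{0..T}. u t = P t +
                prabhakar \<rho> \<mu> \<omega> \<gamma> (\<lambda>s. F s - volterra (resolvent_kernel G\<^sub>P) F s) t)) \<and>
          (\<forall>v. continuous_on {0..T} v \<longrightarrow>
             (satisfies_equation T m \<rho> \<mu> \<omega> \<gamma> N p \<beta> K f (\<lambda>t. P t + prabhakar \<rho> \<mu> \<omega> \<gamma> v t) \<longleftrightarrow>
              (\<forall>t\<in>{0..T}. v t + volterra G\<^sub>P v t = F t)))))"
proof -
  have \<mu>: "\<mu> > 0" using assms(2,3) by linarith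
  have \<beta>: "\<forall>j\<in>{1..N}. 0 \<le> \<beta> j \<and> \<beta> j < \<mu>" using assms(6) by blast
  have p: "\<forall>j\<in>{1..N}. continuous_on {0..T} (p j)" using assms(7) by blast
  note hyps = assms(1) \<mu> assms(5) \<beta> p assms(8)
  note pres = volterra_reduced_kernel_continuous[OF hyps, where \<omega>=\<omega> and \<gamma>=\<gamma>, folded G\<^sub>P_def]
  obtain \<eta> C where G: "weakly_singular T \<eta> C G\<^sub>P"
    using reduced_kernel_weakly_singular[OF hyps, where \<omega>=\<omega> and \<gamma>=\<gamma>] unfolding G\<^sub>P_def by blast
  show ?thesis
  proof (intro conjI allI impI)
    show "admissible_kernel T G\<^sub>P" by (rule weakly_singular_admissible[OF G pres])
    fix f :: "real \<Rightarrow> complex" and d :: "nat \<Rightarrow> complex"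
    assume f: "continuous_on {0..T} f"
    define P where "P = (\<lambda>t. poly (jet_poly m d) (complex_of_real t))"
    define F where "F = reduced_rhs m N p \<beta> K f d"
    define solution where "solution = (\<lambda>u. u \<in> slice T m \<rho> \<mu> \<omega> \<gamma> d \<and>
              satisfies_equation T m \<rho> \<mu> \<omega> \<gamma> N p \<beta> K f u \<and> has_initial_jet T m u d)"
    have dec: "decomposes T m \<rho> \<mu> \<omega> \<gamma> u (jet_poly m d) v \<longleftrightarrow>
        continuous_on {0..T} v \<and> (\<forall>t\<in>{0..T}. u t = P t + prabhakar \<rho> \<mu> \<omega> \<gamma> v t)" for u v
      using degree_jet_poly[OF assms(2)] by (simp add: decomposes_def P_def)
    have eqn: "satisfies_equation T m \<rho> \<mu> \<omega> \<gamma> N p \<beta> K f u \<longleftrightarrow> (\<forall>t\<in>{0..T}. v t + volterra G\<^sub>P v t = F t)"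
      if "decomposes T m \<rho> \<mu> \<omega> \<gamma> u (jet_poly m d) v" for u v
      unfolding G\<^sub>P_def F_def
      by (rule satisfies_equation_iff_volterra[OF assms(1,3) \<mu> assms(5) \<beta> p assms(8) that])
    have F: "continuous_on {0..T} F"
    proof -
      obtain D where K1: "weakly_singular T 1 D K"
        using weakly_singular_continuous_kernel(1)[OF assms(8)] by blast
      show ?thesis unfolding F_def reduced_rhs_def[abs_def]
        by (intro continuous_on_diff continuous_on_sum continuous_on_mult f assms(7) caputo_poly_continuous
            volterra_continuous[OF K1 assms(1) weakly_singular_continuous_kernel(2)[OF assms(8)]])
           (use assms(6) in \<open>auto intro!: continuous_intros\<close>)
    qed
    define v where "v = (\<lambda>t. F t - volterra (resolvent_kernel G\<^sub>P) F t)"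
    have v: "continuous_on {0..T} v" "\<And>t. t \<in> {0..T} \<Longrightarrow> v t + volterra G\<^sub>P v t = F t"
      using resolvent_solves_volterra[OF G assms(1) pres F] unfolding v_def by auto
    define u where "u = (\<lambda>t. P t + prabhakar \<rho> \<mu> \<omega> \<gamma> v t)"
    have du: "decomposes T m \<rho> \<mu> \<omega> \<gamma> u (jet_poly m d) v"
      using v(1) by (simp add: dec u_def)
    have "u \<in> slice T m \<rho> \<mu> \<omega> \<gamma> d"
      using du unfolding dec slice_def P_def by blast
    moreover have "has_initial_jet T m u d"
      by (rule decomposition_jet[OF du assms(1,5,3)]) (simp add: coeff_jet_poly)
    moreover have "satisfies_equation T m \<rho> \<mu> \<omega> \<gamma> N p \<beta> K f u"
      unfolding eqn[OF du] using v(2) by blast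
    ultimately have sol: "solution u" unfolding solution_def by blast
    have uniq: "w t = u t" if w: "solution w" and t: "t \<in> {0..T}" for w t
    proof -
      obtain v' where dw: "decomposes T m \<rho> \<mu> \<omega> \<gamma> w (jet_poly m d) v'"
        using w unfolding solution_def slice_def dec P_def by blast
      then have v': "continuous_on {0..T} v'" by (simp add: dec)
      have eq': "v' s + volterra G\<^sub>P v' s = F s" if "s \<in> {0..T}" for s
        using w eqn[OF dw] that unfolding solution_def by blast
      have eq: "v' s = v s" if s: "s \<in> {0..T}" for s
      proof -
        have "v' s - v s = 0"
        proof (rule volterra_homogeneous_unique[OF G assms(1) _ _ s])
          show "continuous_on {0..T} (\<lambda>s. v' s - v s)" by (intro continuous_on_diff v' v)
          fix r assume r: "r \<in> {0..T}"
          then have "volterra G\<^sub>P (\<lambda>s. v' s - v s) r = volterra G\<^sub>P v' r - volterra G\<^sub>P v r"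
            by (intro volterra_diff[OF G v' v(1)]) auto
          then have "v' r - v r + volterra G\<^sub>P (\<lambda>s. v' s - v s) r
              = (v' r + volterra G\<^sub>P v' r) - (v r + volterra G\<^sub>P v r)" by simp
          then show "v' r - v r + volterra G\<^sub>P (\<lambda>s. v' s - v s) r = 0"
            using eq'[OF r] v(2)[OF r] by simp
        qed
        then show ?thesis by simp
      qed
      have "prabhakar \<rho> \<mu> \<omega> \<gamma> v' t = prabhakar \<rho> \<mu> \<omega> \<gamma> v t"
        unfolding prabhakar_eq_volterra using t eq by (intro volterra_cong) auto
      then show ?thesis using dw t by (simp add: dec u_def)
    qed
    have "(\<exists>u. solution u \<and> (\<forall>w. solution w \<longrightarrow> (\<forall>t\<in>{0..T}. w t = u t)) \<and>
             (\<forall>t\<in>{0..T}. u t = P t +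
                prabhakar \<rho> \<mu> \<omega> \<gamma> (\<lambda>s. F s - volterra (resolvent_kernel G\<^sub>P) F s) t)) \<and>
          (\<forall>v. continuous_on {0..T} v \<longrightarrow>
             (satisfies_equation T m \<rho> \<mu> \<omega> \<gamma> N p \<beta> K f (\<lambda>t. P t + prabhakar \<rho> \<mu> \<omega> \<gamma> v t) \<longleftrightarrow>
              (\<forall>t\<in>{0..T}. v t + volterra G\<^sub>P v t = F t)))"
    proof (intro conjI exI[of _ u] allI impI)
      show "\<forall>t\<in>{0..T}. u t = P t +
                prabhakar \<rho> \<mu> \<omega> \<gamma> (\<lambda>s. F s - volterra (resolvent_kernel G\<^sub>P) F s) t"
        by (simp add: u_def v_def)
      fix y :: "real \<Rightarrow> complex" assume "continuous_on {0..T} y"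
      then show "satisfies_equation T m \<rho> \<mu> \<omega> \<gamma> N p \<beta> K f (\<lambda>t. P t + prabhakar \<rho> \<mu> \<omega> \<gamma> y t) \<longleftrightarrow>
              (\<forall>t\<in>{0..T}. y t + volterra G\<^sub>P y t = F t)"
        by (intro eqn) (simp add: dec)
    qed (use sol uniq in auto)
    then show "let P = (\<lambda>t. poly (jet_poly m d) (complex_of_real t));
           F = reduced_rhs m N p \<beta> K f d;
           solution = (\<lambda>u. u \<in> slice T m \<rho> \<mu> \<omega> \<gamma> d \<and>
              satisfies_equation T m \<rho> \<mu> \<omega> \<gamma> N p \<beta> K f u \<and> has_initial_jet T m u d)
       in (\<exists>u. solution u \<and>
             (\<forall>w. solution w \<longrightarrow> (\<forall>t\<in>{0..T}. w t = u t)) \<and>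
             (\<forall>t\<in>{0..T}. u t = P t +
                prabhakar \<rho> \<mu> \<omega> \<gamma> (\<lambda>s. F s - volterra (resolvent_kernel G\<^sub>P) F s) t)) \<and>
          (\<forall>v. continuous_on {0..T} v \<longrightarrow>
             (satisfies_equation T m \<rho> \<mu> \<omega> \<gamma> N p \<beta> K f (\<lambda>t. P t + prabhakar \<rho> \<mu> \<omega> \<gamma> v t) \<longleftrightarrow>
              (\<forall>t\<in>{0..T}. v t + volterra G\<^sub>P v t = F t)))"
      unfolding Let_def solution_def P_def F_def .
  qed
qed

end
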